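(* Let $\mathcal{L}$ be the set consisting of the following five-dimensional complex algebras, each with basis $e_1,\dots,e_5$ and all unlisted products of basis elements equal to zero: - $\mathbb{C}^5$ (zero multiplication); - $\mathfrak{H}_{01}$: $e_1e_1=e_5$; - $\mathfrak{H}_{02}$: $e_1e_2=-e_5,\ e_2e_1=e_5,\ e_2e_2=e_5$; - $\mathfrak{H}_{03}^{\lambda}$: $e_1e_2=e_5,\ e_2e_1=\lambda e_5$; - $\mathfrak{H}_{04}$: $e_1e_1=e_5,\ e_2e_3=-e_5,\ e_3e_2=e_5,\ e_3e_3=e_5$; - $\mathfrak{H}_{05}^{\lambda}$: $e_1e_1=e_5,\ e_2e_3=e_5,\ e_3e_2=\lambda e_5$; - $\mathfrak{H}_{06}$: $e_1e_2=e_5,\ e_2e_3=e_5$; - $\mathfrak{H}_{07}$: $e_1e_3=e_5,\ e_2e_2=-e_5,\ e_2e_3=-e_5,\ e_3e_1=e_5,\ e_3e_2=e_5$; - $\mathfrak{H}_{08}$: $e_1e_4=-e_5,\ e_2e_3=e_5,\ e_2e_4=e_5,\ e_3e_2=-e_5,\ e_3e_3=-e_5,\ e_4e_1=e_5,\ e_4e_2=e_5$; - $\mathfrak{H}_{09}^{\lambda}$ ($\lambda\ne-1,0$): $e_1e_3=e_5,\ e_2e_4=e_5,\ e_3e_1=\lambda e_5,\ e_3e_2=e_5,\ e_4e_2=\lambda e_5$; - $\mathfrak{H}_{10}$: $e_1e_1=e_5,\ e_2e_3=e_5,\ e_3e_4=e_5$; - $\mathfrak{H}_{11}$: $e_1e_1=e_5,\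 e_2e_4=e_5,\ e_3e_3=-e_5,\ e_3e_4=-e_5,\ e_4e_2=e_5,\ e_4e_3=e_5$; - $\mathfrak{H}_{12}$: $e_1e_2=-e_5,\ e_2e_1=e_5,\ e_2e_2=e_5,\ e_3e_4=-e_5,\ e_4e_3=e_5,\ e_4e_4=e_5$; - $\mathfrak{H}_{13}^{\lambda;\mu}$: $e_1e_2=e_5,\ e_2e_1=\mu e_5,\ e_3e_4=e_5,\ e_4e_3=\lambda e_5$; - $\mathfrak{H}_{14}^{\lambda}$: $e_1e_2=e_5,\ e_2e_1=\lambda e_5,\ e_3e_4=-e_5,\ e_4e_3=e_5,\ e_4e_4=e_5$; - $\mathfrak{H}_{15}$: $e_1e_2=e_5,\ e_2e_3=e_5,\ e_3e_4=e_5$. All parameters $\lambda,\mu$ lie in $\mathbb{C}_{|\cdot|\le 1}$, and for $\mathfrak{H}_{13}^{\lambda;\mu}$ also $\lambda-\mu\in\mathbb{C}_{\ge0}$. (These are, up to isomorphism, exactly the five-dimensional complex noncommutative Heisenberg algebras, pairwise non-isomorphic.) Let $\Gamma$ be the directed graph on $\mathcal{L}$ with the following edges: - $\mathfrak{H}_{02}\to\mathfrak{H}_{01}$, $\mathfrak{H}_{02}\to\mathfrak{H}_{03}^{-1}$; - $\mathfrak{H}_{03}^{\lambda}\to\mathfrak{H}_{01}$ for $\lambda\ne-1$; - $\mathfrak{H}_{03}^{-1}\to\mathbb{C}^5$, $\mathfrak{H}_{01}\to\mathbb{C}^5$; - $\mathfrak{H}_{04}\to\mathfrak{H}_{05}^{-1}$,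 $\mathfrak{H}_{04}\to\mathfrak{H}_{06}$; - $\mathfrak{H}_{05}^{\lambda}\to\mathfrak{H}_{06}$ for $\lambda\ne\pm1$; - $\mathfrak{H}_{05}^{1}\to\mathfrak{H}_{03}^{1}$; - $\mathfrak{H}_{05}^{-1}\to\mathfrak{H}_{02}$; - $\mathfrak{H}_{06}\to\mathfrak{H}_{02}$, and $\mathfrak{H}_{06}\to\mathfrak{H}_{03}^{\lambda}$ for every $\lambda$; - $\mathfrak{H}_{07}\to\mathfrak{H}_{05}^{1}$, $\mathfrak{H}_{07}\to\mathfrak{H}_{06}$; - $\mathfrak{H}_{08}\to\mathfrak{H}_{10}$, $\mathfrak{H}_{08}\to\mathfrak{H}_{12}$; - $\mathfrak{H}_{09}^{\lambda}\to\mathfrak{H}_{10}$ for $\lambda\ne1$, and $\mathfrak{H}_{09}^{\lambda}\to\mathfrak{H}_{13}^{\lambda;\lambda}$ for every admissible $\lambda$; - $\mathfrak{H}_{09}^{1}\to\mathfrak{H}_{07}$; - $\mathfrak{H}_{10}\to\mathfrak{H}_{04}$, $\mathfrak{H}_{10}\to\mathfrak{H}_{07}$, and $\mathfrak{H}_{10}\to\mathfrak{H}_{05}^{\lambda}$ for every $\lambda$; - $\mathfrak{H}_{11}\to\mathfrak{H}_{09}^{1}$, $\mathfrak{H}_{11}\to\mathfrak{H}_{10}$; - $\mathfrak{H}_{12}\to\mathfrak{H}_{04}$, $\mathfrak{H}_{12}\to\mathfrak{H}_{14}^{-1}$; - $\mathfrak{H}_{13}^{\lambda;-1}\to\mathfrak{H}_{04}$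 for $\lambda\ne-1$; - $\mathfrak{H}_{13}^{\lambda;\lambda}\to\mathfrak{H}_{05}^{\lambda}$ for $\lambda\ne-1$; - $\mathfrak{H}_{13}^{\lambda;\mu}\to\mathfrak{H}_{10}$ for $\lambda\ne-1$, $\mu\ne-1$, $\mu\ne\lambda$; - $\mathfrak{H}_{13}^{-1;-1}\to\mathfrak{H}_{03}^{-1}$; - $\mathfrak{H}_{14}^{-1}\to\mathfrak{H}_{05}^{-1}$, $\mathfrak{H}_{14}^{-1}\to\mathfrak{H}_{13}^{-1;-1}$; - $\mathfrak{H}_{14}^{\lambda}\to\mathfrak{H}_{10}$ and $\mathfrak{H}_{14}^{\lambda}\to\mathfrak{H}_{13}^{\lambda;-1}$ for $\lambda\ne-1$; - $\mathfrak{H}_{15}\to\mathfrak{H}_{10}$, $\mathfrak{H}_{15}\to\mathfrak{H}_{13}^{0;0}$. Then for $\mathbf{A},\mathbf{B}\in\mathcal{L}$, $\mathbf{A}$ degenerates to $\mathbf{B}$ if and only if there is a directed path in $\Gamma$ (possibly of length zero) from $\mathbf{A}$ to $\mathbf{B}$.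
   Context: An algebra is a finite-dimensional complex vector space with an arbitrary bilinear multiplication. An algebra $\mathfrak{H}$ is a noncommutative Heisenberg algebra if $\dim\mathfrak{H}^2\le1$ and $\mathfrak{H}^2\mathfrak{H}+\mathfrak{H}\mathfrak{H}^2=0$. Let $V=\mathbb{C}^5$. Algebra structures on $V$ are the elements $\mu\in\mathrm{Hom}(V\otimes V,V)\cong\mathbb{C}^{125}$, viewed as an affine space with the Zariski topology. $\mathrm{GL}(V)$ acts on this space by $(g*\mu)(x\otimes y)=g\mu(g^{-1}x\otimes g^{-1}y)$. For algebras $\mathbf{A},\mathbf{B}$ on $V$ represented by structures $\mu,\lambda$, we say $\mathbf{A}$ degenerates to $\mathbf{B}$ if $\lambda$ lies in the Zariski closure of the orbit $\mathrm{GL}(V)*\mu$. This does not depend on the chosen representatives. We set $$\mathbb{C}_{|\cdot|\le 1}=\{x\in\mathbb{C}: |x|<1\}\cup\{x\in\mathbb{C}: |x|=1,\ \mathrm{Im}(x)\ge 0\},$$ $$\mathbb{C}_{\ge 0}=\{x\in\mathbb{C}:\mathrm{Re}(x)>0\}\cup\{x\in\mathbb{C}:\mathrm{Re}(x)=0,\ \mathrm{Im}(x)\ge 0\}.$$ *)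

theory Defs
  imports "HOL-Analysis.Analysis"
begin

text \<open>An algebra structure on V = C^5 (basis e_1..e_5, indexed by the elements
  0..4 of the numeral type 5) is given by its structure constants:
  mu (i,j,k) is the coefficient of e_k in the product e_i e_j.
  This identifies Hom(V (x) V, V) with C^125.\<close>

type_synonym struct = "5 \<times> 5 \<times> 5 \<Rightarrow> complex"

inductive zpoly :: "(('n::finite \<Rightarrow> complex) \<Rightarrow> complex) \<Rightarrow> bool" where
  zpoly_const: "zpoly (\<lambda>x. c)"
| zpoly_var: "zpoly (\<lambda>x. x n)"
| zpoly_add: "zpoly p \<Longrightarrow> zpoly q \<Longrightarrow> zpoly (\<lambda>x. p x + q x)"
| zpoly_mult: "zpoly p \<Longrightarrow> zpoly q \<Longrightarrow> zpoly (\<lambda>x. p x * q x)"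

definition zariski_closure :: "('n::finite \<Rightarrow> complex) set \<Rightarrow> ('n \<Rightarrow> complex) set" where
  "zariski_closure S = {x. \<forall>p. zpoly p \<longrightarrow> (\<forall>s\<in>S. p s = 0) \<longrightarrow> p x = 0}"

text \<open>Action (g*mu)(x (x) y) = g mu(g^-1 x (x) g^-1 y) in structure constants;
  g $ r $ c is the entry in row r, column c.\<close>

definition act :: "complex^5^5 \<Rightarrow> struct \<Rightarrow> struct" where
  "act g mu = (\<lambda>(i,j,k). let h = matrix_inv g in
      \<Sum>a\<in>UNIV. \<Sum>b\<in>UNIV. \<Sum>c\<in>UNIV. h$a$i * h$b$j * mu (a,b,c) * g$k$c)"

definition orbit :: "struct \<Rightarrow> struct set" where
  "orbit mu = {act g mu | g. invertible g}"

definition degenerates :: "struct \<Rightarrow> struct \<Rightarrow> bool" where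
  "degenerates mu lam \<longleftrightarrow> lam \<in> zariski_closure (orbit mu)"

definition cle1 :: "complex set" where
  "cle1 = {x. cmod x < 1} \<union> {x. cmod x = 1 \<and> Im x \<ge> 0}"

definition cge0 :: "complex set" where
  "cge0 = {x. Re x > 0} \<union> {x. Re x = 0 \<and> Im x \<ge> 0}"

datatype alg = C5 | H01 | H02 | H03 complex | H04 | H05 complex | H06 | H07 | H08
  | H09 complex | H10 | H11 | H12 | H13 complex complex | H14 complex | H15

fun valid :: "alg \<Rightarrow> bool" where
  "valid (H03 l) = (l \<in> cle1)"
| "valid (H05 l) = (l \<in> cle1)"
| "valid (H09 l) = (l \<in> cle1 \<and> l \<noteq> -1 \<and> l \<noteq> 0)"
| "valid (H13 l m) = (l \<in> cle1 \<and> m \<in> cle1 \<and> l - m \<in> cge0)"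
| "valid (H14 l) = (l \<in> cle1)"
| "valid _ = True"

text \<open>Basis index: e_n (n = 1..5) corresponds to the element n-1 of type 5.\<close>

definition bidx :: "nat \<Rightarrow> 5" where
  "bidx n = of_nat (n - 1)"

text \<open>A table entry (i,j,c) means e_i e_j = c e_5; unlisted products are zero.\<close>

definition table_struct :: "(nat \<times> nat \<times> complex) list \<Rightarrow> struct" where
  "table_struct tbl = (\<lambda>(p,q,r). if r = bidx 5 then
      sum_list (map (\<lambda>(i,j,c). if bidx i = p \<and> bidx j = q then c else 0) tbl) else 0)"

fun table :: "alg \<Rightarrow> (nat \<times> nat \<times> complex) list" where
  "table C5 = []"
| "table H01 = [(1,1,1)]"
| "table H02 = [(1,2,-1),(2,1,1),(2,2,1)]"
| "table (H03 l) = [(1,2,1),(2,1,l)]"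
| "table H04 = [(1,1,1),(2,3,-1),(3,2,1),(3,3,1)]"
| "table (H05 l) = [(1,1,1),(2,3,1),(3,2,l)]"
| "table H06 = [(1,2,1),(2,3,1)]"
| "table H07 = [(1,3,1),(2,2,-1),(2,3,-1),(3,1,1),(3,2,1)]"
| "table H08 = [(1,4,-1),(2,3,1),(2,4,1),(3,2,-1),(3,3,-1),(4,1,1),(4,2,1)]"
| "table (H09 l) = [(1,3,1),(2,4,1),(3,1,l),(3,2,1),(4,2,l)]"
| "table H10 = [(1,1,1),(2,3,1),(3,4,1)]"
| "table H11 = [(1,1,1),(2,4,1),(3,3,-1),(3,4,-1),(4,2,1),(4,3,1)]"
| "table H12 = [(1,2,-1),(2,1,1),(2,2,1),(3,4,-1),(4,3,1),(4,4,1)]"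
| "table (H13 l m) = [(1,2,1),(2,1,m),(3,4,1),(4,3,l)]"
| "table (H14 l) = [(1,2,1),(2,1,l),(3,4,-1),(4,3,1),(4,4,1)]"
| "table H15 = [(1,2,1),(2,3,1),(3,4,1)]"

definition alg_struct :: "alg \<Rightarrow> struct" where
  "alg_struct A = table_struct (table A)"

inductive edge0 :: "alg \<Rightarrow> alg \<Rightarrow> bool" where
  "edge0 H02 H01"
| "edge0 H02 (H03 (-1))"
| "l \<noteq> -1 \<Longrightarrow> edge0 (H03 l) H01"
| "edge0 (H03 (-1)) C5"
| "edge0 H01 C5"
| "edge0 H04 (H05 (-1))"
| "edge0 H04 H06"
| "l \<noteq> 1 \<Longrightarrow> l \<noteq> -1 \<Longrightarrow> edge0 (H05 l) H06"
| "edge0 (H05 1) (H03 1)"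
| "edge0 (H05 (-1)) H02"
| "edge0 H06 H02"
| "edge0 H06 (H03 l)"
| "edge0 H07 (H05 1)"
| "edge0 H07 H06"
| "edge0 H08 H10"
| "edge0 H08 H12"
| "l \<noteq> 1 \<Longrightarrow> edge0 (H09 l) H10"
| "edge0 (H09 l) (H13 l l)"
| "edge0 (H09 1) H07"
| "edge0 H10 H04"
| "edge0 H10 H07"
| "edge0 H10 (H05 l)"
| "edge0 H11 (H09 1)"
| "edge0 H11 H10"
| "edge0 H12 H04"
| "edge0 H12 (H14 (-1))"
| "l \<noteq> -1 \<Longrightarrow> edge0 (H13 l (-1)) H04"
| "l \<noteq> -1 \<Longrightarrow> edge0 (H13 l l) (H05 l)"
| "l \<noteq> -1 \<Longrightarrow> m \<noteq> -1 \<Longrightarrow> m \<noteq> l \<Longrightarrow> edge0 (H13 l m) H10"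
| "edge0 (H13 (-1) (-1)) (H03 (-1))"
| "edge0 (H14 (-1)) (H05 (-1))"
| "edge0 (H14 (-1)) (H13 (-1) (-1))"
| "l \<noteq> -1 \<Longrightarrow> edge0 (H14 l) H10"
| "l \<noteq> -1 \<Longrightarrow> edge0 (H14 l) (H13 l (-1))"
| "edge0 H15 H10"
| "edge0 H15 (H13 0 0)"

definition gamma_edge :: "alg \<Rightarrow> alg \<Rightarrow> bool" where
  "gamma_edge A B \<longleftrightarrow> valid A \<and> valid B \<and> edge0 A B"

end

theory Submission
  imports Defs "HOL-Computational_Algebra.Polynomial"
begin

text \<open>
  All products lie in the line spanned by \<open>e\<^sub>5\<close>, which annihilates the algebra, so each algebra
  is a bilinear form \<open>F\<close> on \<open>\<complex>\<^sup>4\<close>, and degeneration of algebras is the Zariski closure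
  relation for the congruence action \<open>F \<mapsto> E F E\<^sup>T\<close>; since invertible frames \<open>E\<close> are dense, singular
  \<open>E\<close> may be admitted. Degenerations are then given by frames whose Gram matrix tends to the target.

  Non-degenerations come from the pencil \<open>x F + y F\<^sup>T\<close>: its determinant on a leading block that supports
  \<open>F\<close> is determined up to a scalar, which recovers the unordered parameters because \<open>\<lambda>\<close> and \<open>1/\<lambda>\<close>
  never both satisfy the normalisation unless they coincide; the rank of the pencil at a fixed \<open>(x, y)\<close>
  cannot increase. One case, \<open>H09 1\<close>, needs a cubic: there the skew part is \<open>a \<and> b\<close> and the symmetric
  part lies in the ideal \<open>(a, b)\<close>, so the form vanishes on the cross product of \<open>a\<close> and \<open>b\<close> in every
  three-dimensional subspace. Transitivity along the graph reduces everything else to these.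
\<close>

section \<open>Polynomial functions and reduction to bilinear forms on \<open>\<complex>\<^sup>4\<close>\<close>

lemma zpoly_uminus:
  assumes "zpoly p" shows "zpoly (\<lambda>x. - p x)"
  using zpoly_mult[OF zpoly_const[of "-1"] assms] by simp

lemma zpoly_diff:
  assumes "zpoly p" "zpoly q" shows "zpoly (\<lambda>x. p x - q x)"
  using zpoly_add[OF assms(1) zpoly_uminus[OF assms(2)]] by simp

lemma zpoly_sum:
  assumes "\<And>s. s \<in> S \<Longrightarrow> zpoly (f s)"
  shows "zpoly (\<lambda>x. \<Sum>s\<in>S. f s x)"
  using assms by (induction S rule: infinite_finite_induct) (auto intro: zpoly_const zpoly_add)

lemma zpoly_prod:
  assumes "\<And>s. s \<in> S \<Longrightarrow> zpoly (f s)"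
  shows "zpoly (\<lambda>x. \<Prod>s\<in>S. f s x)"
  using assms by (induction S rule: infinite_finite_induct) (auto intro: zpoly_const zpoly_mult)

lemma zpoly_if:
  assumes "zpoly p" "zpoly q"
  shows "zpoly (\<lambda>x. if b then p x else q x)"
  using assms by (cases b) simp_all

lemmas zpoly_intros = zpoly_if
  zpoly_const zpoly_var zpoly_add zpoly_mult zpoly_uminus zpoly_diff zpoly_sum zpoly_prod

lemma zpoly_compose:
  assumes "zpoly p" "\<And>i. zpoly (\<lambda>x. f x i)"
  shows "zpoly (\<lambda>x. p (f x))"
  using assms by induction (auto intro: zpoly_intros)

lemma zpoly_det:
  fixes M :: "('m::finite \<Rightarrow> complex) \<Rightarrow> 'n::finite \<Rightarrow> 'n \<Rightarrow> complex"
  assumes "\<And>i j. zpoly (\<lambda>x. M x i j)"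
  shows "zpoly (\<lambda>x. det (\<chi> i j. M x i j))"
  unfolding det_def using assms by (auto intro!: zpoly_intros)

text \<open>Along a curve with polynomial coordinates everything becomes univariate, so density of
  the invertible frames reduces to the absence of zero divisors among polynomials.\<close>

lemma zpoly_on_poly_curve:
  assumes "zpoly p"
  shows "\<exists>P. \<forall>t. p (\<lambda>i. poly (c i) t) = poly P t"
  using assms
proof induction
  case (zpoly_const a)
  show ?case by (intro exI[of _ "[:a:]"]) simp
next
  case (zpoly_var n)
  show ?case by blast
next
  case (zpoly_add p q)
  then show ?case by (metis poly_add)
next
  case (zpoly_mult p q)
  then show ?case by (metis poly_mult)
qed

lemma zpoly_isCont_curve:
  fixes N :: "complex \<Rightarrow> 'n::finite \<Rightarrow> complex"
  assumes "zpoly p" "\<And>i. isCont (\<lambda>t. N t i) a"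
  shows "isCont (\<lambda>t. p (N t)) a"
  using assms by induction (auto intro!: continuous_intros)

section \<open>Bilinear forms on four-space and their Gram matrices\<close>

type_synonym form4 = "4 \<times> 4 \<Rightarrow> complex"

text \<open>This is E F E^T, the Gram matrix of the rows of \<open>E\<close> under the form
  \<open>F\<close>.\<close>

definition pull :: "(4 \<Rightarrow> 4 \<Rightarrow> complex) \<Rightarrow> form4 \<Rightarrow> form4" where
  "pull E F = (\<lambda>(i,j). \<Sum>a\<in>UNIV. \<Sum>b\<in>UNIV. E i a * F (a,b) * E j b)"

definition zdeg :: "form4 \<Rightarrow> form4 \<Rightarrow> bool" where
  "zdeg F G \<longleftrightarrow> G \<in> zariski_closure (range (\<lambda>E. pull E F))"

lemma zdegD: "zdeg F G \<Longrightarrow> zpoly p \<Longrightarrow> (\<And>E. p (pull E F) = 0) \<Longrightarrow> p G = 0"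
  by (auto simp: zdeg_def zariski_closure_def)

lemma zdegI: "(\<And>p. zpoly p \<Longrightarrow> (\<And>E. p (pull E F) = 0) \<Longrightarrow> p G = 0) \<Longrightarrow> zdeg F G"
  by (auto simp: zdeg_def zariski_closure_def)

lemma zpoly_pull: "zpoly (\<lambda>F. pull E F ij)"
  by (cases ij) (auto simp: pull_def intro!: zpoly_intros)

lemma pull_pull: "pull E (pull E' F) = pull (\<lambda>i a. \<Sum>c\<in>UNIV. E i c * E' c a) F"
proof -
  have "(\<Sum>a\<in>UNIV. \<Sum>b\<in>UNIV. E i a * (\<Sum>c\<in>UNIV. \<Sum>d\<in>UNIV. E' a c * F (c,d) * E' b d) * E j b)
      = (\<Sum>c\<in>UNIV. \<Sum>d\<in>UNIV. (\<Sum>a\<in>UNIV. E i a * E' a c) * F (c,d) * (\<Sum>b\<in>UNIV. E j b * E' b d))" (is "?L = ?R") for i j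
  proof -
    have "?L = (\<Sum>a\<in>UNIV. \<Sum>b\<in>UNIV. \<Sum>c\<in>UNIV. \<Sum>d\<in>UNIV. E i a * E' a c * F (c,d) * E' b d * E j b)"
      by (simp add: sum_distrib_left sum_distrib_right mult_ac)
    also have "\<dots> = (\<Sum>a\<in>UNIV. \<Sum>c\<in>UNIV. \<Sum>b\<in>UNIV. \<Sum>d\<in>UNIV. E i a * E' a c * F (c,d) * E' b d * E j b)"
      by (intro sum.cong refl sum.swap)
    also have "\<dots> = (\<Sum>c\<in>UNIV. \<Sum>a\<in>UNIV. \<Sum>b\<in>UNIV. \<Sum>d\<in>UNIV. E i a * E' a c * F (c,d) * E' b d * E j b)"
      by (rule sum.swap)
    also have "\<dots> = (\<Sum>c\<in>UNIV. \<Sum>a\<in>UNIV. \<Sum>d\<in>UNIV. \<Sum>b\<in>UNIV. E i a * E' a c * F (c,d) * E' b d * E j b)"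
      by (intro sum.cong refl sum.swap)
    also have "\<dots> = (\<Sum>c\<in>UNIV. \<Sum>d\<in>UNIV. \<Sum>a\<in>UNIV. \<Sum>b\<in>UNIV. E i a * E' a c * F (c,d) * E' b d * E j b)"
      by (intro sum.cong refl sum.swap)
    also have "\<dots> = ?R"
      by (simp add: sum_distrib_left sum_distrib_right mult_ac)
    finally show ?thesis .
  qed
  then show ?thesis by (simp add: pull_def fun_eq_iff)
qed

text \<open>For fixed \<open>E\<close> the function \<open>p (pull E _)\<close> is again polynomial,
  and by \<open>pull_pull\<close> it vanishes on all Gram matrices of \<open>F\<close>, hence at
  \<open>G\<close>. So \<open>p\<close> vanishes on all Gram matrices of \<open>G\<close>.\<close>

lemma zdeg_trans:
  assumes "zdeg F G" "zdeg G H"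
  shows "zdeg F H"
proof (rule zdegI)
  fix p :: "form4 \<Rightarrow> complex"
  assume p: "zpoly p" and van: "\<And>E. p (pull E F) = 0"
  have "p (pull E G) = 0" for E
    using zdegD[OF assms(1) zpoly_compose[OF p zpoly_pull]] by (simp add: pull_pull van)
  then show "p H = 0" using zdegD[OF assms(2) p] by blast
qed

text \<open>Polynomial functions are continuous, so a Zariski closure contains ordinary limits. The
  frames are only constrained for nonzero \<open>t\<close> and may have a pole at 0.\<close>

lemma zdeg_limit:
  fixes N :: "complex \<Rightarrow> form4"
  assumes "\<And>t. t \<noteq> 0 \<Longrightarrow> pull (E t) F = N t" "\<And>i j. isCont (\<lambda>t. N t (i,j)) 0"
  shows "zdeg F (N 0)"
proof (rule zdegI)
  fix p :: "form4 \<Rightarrow> complex"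
  assume p: "zpoly p" and van: "\<And>E. p (pull E F) = 0"
  have "isCont (\<lambda>t. p (N t)) 0"
    using assms(2) by (intro zpoly_isCont_curve[OF p]) auto
  then have "((\<lambda>t. p (N t)) \<longlongrightarrow> p (N 0)) (at 0)" by (simp add: isCont_def)
  moreover have "((\<lambda>t. p (N t)) \<longlongrightarrow> 0) (at 0)"
    by (rule tendsto_eventually) (auto simp: eventually_at_filter simp flip: assms(1) simp: van)
  ultimately show "p (N 0) = 0" by (rule LIM_unique)
qed

lemma zdeg_pull: "zdeg F (pull E F)"
  by (auto intro!: zdegI)

text \<open>The type \<open>4\<close> is arithmetic modulo 4, so the index 4 is the element 0; the
  last branch serves it.\<close>

definition quad :: "'a \<Rightarrow> 'a \<Rightarrow> 'a \<Rightarrow> 'a \<Rightarrow> 4 \<Rightarrow> 'a" where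
  "quad a b c d i = (if i = 1 then a else if i = 2 then b else if i = 3 then c else d)"

lemma quad_simps [simp]:
  "quad a b c d 1 = a" "quad a b c d 2 = b" "quad a b c d 3 = c" "quad a b c d 4 = d" "quad a b c d 0 = d"
  by (simp_all add: quad_def)

lemma pull_id: "pull (\<lambda>i a. if i = a then 1 else 0) F = F"
  by (auto simp: pull_def if_distrib[of "\<lambda>x. x * _"] if_distrib[of "\<lambda>x. _ * x"] cong: if_cong)

section \<open>Passage between algebra structures on five-space and forms on four-space\<close>

definition emb :: "4 \<Rightarrow> 5" where
  "emb = quad 0 1 2 3"

text \<open>The vectors e_1, ..., e_4 have indices 0 to 3 in type \<open>5\<close> but 1 to 4 in
  type \<open>4\<close>. The index of e_5 falls into the last branch as well, so uses of
  \<open>proj\<close> exclude it.\<close>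

definition proj :: "5 \<Rightarrow> 4" where
  "proj p = (if p = 0 then 1 else if p = 1 then 2 else if p = 2 then 3 else 4)"

lemma exhaust_5: "(p::5) = 0 \<or> p = 1 \<or> p = 2 \<or> p = 3 \<or> p = 4"
proof (induct p)
  case (of_int z)
  then have "z = 0 \<or> z = 1 \<or> z = 2 \<or> z = 3 \<or> z = 4" by fastforce
  then show ?case by auto
qed

lemma UNIV_5: "(UNIV::5 set) = {0,1,2,3,4}"
  using exhaust_5 by auto

lemma proj_emb [simp]: "proj (emb i) = i"
  using exhaust_4[of i] by (auto simp: emb_def proj_def)

lemma emb_proj: "p \<noteq> 4 \<Longrightarrow> emb (proj p) = p"
  using exhaust_5[of p] by (auto simp: emb_def proj_def)

lemma emb_neq [simp]: "emb i \<noteq> 4"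
  using exhaust_4[of i] by (auto simp: emb_def)

lemma sum_UNIV_5: "(\<Sum>p\<in>UNIV. f p) = (\<Sum>i\<in>UNIV. f (emb i)) + f (4::5)"
  unfolding sum_4 UNIV_5 by (simp add: emb_def algebra_simps)

definition form :: "alg \<Rightarrow> form4" where
  "form A = (\<lambda>(i,j). alg_struct A (emb i, emb j, 4))"

definition extend :: "form4 \<Rightarrow> struct" where
  "extend F = (\<lambda>(p,q,r). if p \<noteq> 4 \<and> q \<noteq> 4 \<and> r = 4 then F (proj p, proj q) else 0)"

lemma bidx_simps: "bidx 1 = 0" "bidx (Suc 0) = 0" "bidx 2 = 1" "bidx 3 = 2" "bidx 4 = 3" "bidx 5 = 4"
  by (simp_all add: bidx_def)

lemma alg_struct_extend: "alg_struct A = extend (form A)"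
proof -
  have "alg_struct A (4,q,r) = 0" "alg_struct A (p,4,r) = 0" for p q r
    by (cases A; simp add: alg_struct_def table_struct_def bidx_simps)+
  moreover have "r \<noteq> 4 \<Longrightarrow> alg_struct A (p,q,r) = 0" for p q r
    by (simp add: alg_struct_def table_struct_def bidx_simps)
  ultimately show ?thesis
    by (auto simp: extend_def form_def fun_eq_iff emb_proj)
qed

text \<open>All products are multiples of e_5, so \<open>g\<close> enters the outer factor only
  through its last column, the image of e_5.\<close>

lemma act_extend:
  "act g (extend F) (p,q,r) =
    (\<Sum>a\<in>UNIV. \<Sum>b\<in>UNIV. matrix_inv g $ emb a $ p * F (a,b) * matrix_inv g $ emb b $ q) * g $ r $ 4"
  by (simp add: act_def extend_def sum_UNIV_5 Let_def sum_distrib_left sum_distrib_right mult_ac)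

text \<open>Reading off the e_5-coordinates of the products of e_1, ..., e_4 is a polynomial map
  that sends every point of the orbit to a Gram matrix of \<open>F\<close>.\<close>

lemma degenerates_imp_zdeg:
  assumes "degenerates (extend F) (extend G)"
  shows "zdeg F G"
proof (rule zdegI)
  fix p :: "form4 \<Rightarrow> complex"
  assume p: "zpoly p" and van: "\<And>E. p (pull E F) = 0"
  define slice :: "struct \<Rightarrow> form4" where "slice m = (\<lambda>(i,j). m (emb i, emb j, 4))" for m
  have "zpoly (\<lambda>m. p (slice m))"
    using p by (rule zpoly_compose) (auto simp: slice_def split: prod.split intro: zpoly_var)
  moreover have "p (slice (act g (extend F))) = 0" for g
  proof -
    \<comment> \<open>The scalar by which \<open>g\<close> multiplies the e_5-coordinate is absorbed
      into the frame: its square root goes into each of the two arguments of the form.\<close>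
    define c where "c = csqrt (g $ 4 $ 4)"
    have c: "g $ 4 $ 4 = c * c" by (simp add: c_def flip: power2_eq_square)
    have "slice (act g (extend F)) = pull (\<lambda>i a. c * matrix_inv g $ emb a $ emb i) F"
      by (auto simp: slice_def fun_eq_iff act_extend pull_def c sum_distrib_left sum_distrib_right mult_ac)
    then show ?thesis by (simp add: van)
  qed
  ultimately have "p (slice (extend G)) = 0"
    using assms by (auto simp: degenerates_def zariski_closure_def orbit_def)
  moreover have "slice (extend G) = G" by (auto simp: slice_def extend_def)
  ultimately show "p G = 0" by simp
qed

lemma matrix_inv_inverse:
  fixes A :: "'a::semiring_1^'n^'m"
  assumes "invertible A"
  shows "A ** matrix_inv A = mat 1" "matrix_inv A ** A = mat 1"
  using assms someI_ex[of "\<lambda>B. A ** B = mat 1 \<and> B ** A = mat 1"]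
  by (auto simp: invertible_def matrix_inv_def)

text \<open>The matrix \<open>h\<close> is the transpose of \<open>E\<close> extended by 1 on e_5,
  and the group element that realises the frame is its inverse.\<close>

lemma extend_pull_in_orbit:
  fixes E :: "4 \<Rightarrow> 4 \<Rightarrow> complex"
  defines "h \<equiv> (\<chi> p q. if p \<noteq> 4 \<and> q \<noteq> 4 then E (proj q) (proj p) else if p = q then 1 else 0) :: complex^5^5"
  assumes "det h \<noteq> 0"
  shows "extend (pull E F) \<in> orbit (extend F)"
proof -
  have inv: "invertible h" using assms by (simp add: invertible_det_nz)
  define g where "g = matrix_inv h"
  have gh: "g ** h = mat 1" "h ** g = mat 1"
    using inv unfolding g_def by (simp_all add: matrix_inv_inverse)
  have ig: "invertible g" using gh by (auto simp: invertible_def)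
  have mg: "matrix_inv g = h"
    using matrix_inv_inverse[OF ig] gh by (metis matrix_mul_assoc matrix_mul_lid matrix_mul_rid)
  \<comment> \<open>The last column of \<open>h\<close> is the basis vector e_5, so its inverse
    fixes e_5 too and the outer factor in \<open>act_extend\<close> is trivial.\<close>
  have col: "g $ r $ 4 = (if r = 4 then 1 else 0)" for r
  proof -
    have "(g ** h) $ r $ 4 = g $ r $ 4"
      by (simp add: matrix_matrix_mult_def h_def sum_UNIV_5)
    then show ?thesis by (simp add: gh mat_def)
  qed
  have ext: "extend (pull E F) (p,q,r) = (if p \<noteq> 4 \<and> q \<noteq> 4 \<and> r = 4 then
      \<Sum>a\<in>UNIV. \<Sum>b\<in>UNIV. E (proj p) a * F (a,b) * E (proj q) b else 0)" for p q r
    by (simp add: extend_def pull_def)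
  have h: "h $ emb a $ p = (if p \<noteq> 4 then E (proj p) a else 0)" for a p
    using emb_neq[of a] by (auto simp: h_def)
  have "act g (extend F) = extend (pull E F)"
    by (simp add: fun_eq_iff act_extend mg col ext h)
  then show ?thesis using ig by (auto simp: orbit_def intro: sym)
qed

text \<open>Invertible frames give points of the orbit, and a polynomial that vanishes for them
  vanishes for singular frames by density.\<close>

lemma zdeg_imp_degenerates:
  assumes "zdeg F G"
  shows "degenerates (extend F) (extend G)"
  unfolding degenerates_def zariski_closure_def
proof (clarify)
  fix p :: "struct \<Rightarrow> complex"
  assume p: "zpoly p" and van: "\<forall>s\<in>orbit (extend F). p s = 0"
  have pe: "zpoly (\<lambda>F. p (extend F))"
    using p by (rule zpoly_compose) (auto simp: extend_def split: prod.split intro: zpoly_intros)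
  have "p (extend (pull E F)) = 0" for E
  proof -
    text \<open>The frames \<open>(1 - t) E + t I\<close> are invertible for almost all \<open>t\<close>, since they are at \<open>t = 1\<close>.\<close>
    define c where "c = (\<lambda>(i,a). [:E i a, (if i = a then 1 else 0) - E i a:])"
    define C where "C t i a = poly (c (i,a)) t" for t i a
    define h where "h x = (\<chi> p q. if p \<noteq> 4 \<and> q \<noteq> 4 then x (proj q, proj p) else if p = q then 1 else 0 :: complex^5^5)"
      for x :: form4
    have "zpoly (\<lambda>x. det (h x))"
      unfolding h_def by (rule zpoly_det) (auto intro: zpoly_intros)
    then obtain D where D: "\<And>t. det (h (\<lambda>ia. poly (c ia) t)) = poly D t"
      using zpoly_on_poly_curve by metis
    have "zpoly (\<lambda>x. p (extend (pull (\<lambda>i a. x (i,a)) F)))"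
      by (rule zpoly_compose[OF pe]) (auto simp: pull_def split: prod.split intro!: zpoly_intros)
    then obtain P where P: "\<And>t. p (extend (pull (\<lambda>i a. poly (c (i,a)) t) F)) = poly P t"
      using zpoly_on_poly_curve[where c = c] by meson
    \<comment> \<open>Where the determinant \<open>D\<close> is nonzero the frame is invertible and
      \<open>P\<close> vanishes. As \<open>D\<close> is not the zero polynomial, \<open>P\<close>
      must be.\<close>
    have "poly (P * D) t = 0" for t
    proof (cases "poly D t = 0")
      case False
      then have "extend (pull (\<lambda>i a. poly (c (i,a)) t) F) \<in> orbit (extend F)"
        unfolding D[symmetric] h_def by (rule extend_pull_in_orbit)
      then show ?thesis using van by (simp flip: P)
    qed simp
    then have "P * D = 0" using poly_all_0_iff_0 by blast
    moreover have "poly D 1 = 1"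
    proof -
      have "h (\<lambda>ia. poly (c ia) 1) = mat 1"
        by (auto simp: h_def c_def mat_def vec_eq_iff) (metis emb_proj)
      then show ?thesis by (simp flip: D)
    qed
    ultimately have "P = 0" by auto
    then show ?thesis using P[of 0] by (simp add: c_def)
  qed
  then show "p (extend G) = 0" using zdegD[OF assms pe] by blast
qed

lemma degenerates_iff_zdeg: "degenerates (alg_struct A) (alg_struct B) \<longleftrightarrow> zdeg (form A) (form B)"
  using degenerates_imp_zdeg zdeg_imp_degenerates by (metis alg_struct_extend)

section \<open>The listed algebras as explicit matrices\<close>

definition mat4 :: "(4 \<Rightarrow> complex) \<Rightarrow> (4 \<Rightarrow> complex) \<Rightarrow> (4 \<Rightarrow> complex) \<Rightarrow> (4 \<Rightarrow> complex) \<Rightarrow> form4" where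
  "mat4 r1 r2 r3 r4 = (\<lambda>(i,j). quad r1 r2 r3 r4 i j)"

lemma mat4_simps [simp]:
  "mat4 r1 r2 r3 r4 (1,j) = r1 j" "mat4 r1 r2 r3 r4 (2,j) = r2 j"
  "mat4 r1 r2 r3 r4 (3,j) = r3 j" "mat4 r1 r2 r3 r4 (4,j) = r4 j" "mat4 r1 r2 r3 r4 (0,j) = r4 j"
  by (simp_all add: mat4_def)

lemma form4_eqI:
  assumes "\<forall>i j. F (i,j) = (G (i,j) :: complex)"
  shows "F = (G :: form4)"
  using assms by auto

lemma form_eqs:
  "form C5 = mat4 (quad 0 0 0 0) (quad 0 0 0 0) (quad 0 0 0 0) (quad 0 0 0 0)"
  "form H01 = mat4 (quad 1 0 0 0) (quad 0 0 0 0) (quad 0 0 0 0) (quad 0 0 0 0)"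
  "form H02 = mat4 (quad 0 (-1) 0 0) (quad 1 1 0 0) (quad 0 0 0 0) (quad 0 0 0 0)"
  "form (H03 l) = mat4 (quad 0 1 0 0) (quad l 0 0 0) (quad 0 0 0 0) (quad 0 0 0 0)"
  "form H04 = mat4 (quad 1 0 0 0) (quad 0 0 (-1) 0) (quad 0 1 1 0) (quad 0 0 0 0)"
  "form (H05 l) = mat4 (quad 1 0 0 0) (quad 0 0 1 0) (quad 0 l 0 0) (quad 0 0 0 0)"
  "form H06 = mat4 (quad 0 1 0 0) (quad 0 0 1 0) (quad 0 0 0 0) (quad 0 0 0 0)"
  "form H07 = mat4 (quad 0 0 1 0) (quad 0 (-1) (-1) 0) (quad 1 1 0 0) (quad 0 0 0 0)"
  "form H08 = mat4 (quad 0 0 0 (-1)) (quad 0 0 1 1) (quad 0 (-1) (-1) 0) (quad 1 1 0 0)"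
  "form (H09 l) = mat4 (quad 0 0 1 0) (quad 0 0 0 1) (quad l 1 0 0) (quad 0 l 0 0)"
  "form H10 = mat4 (quad 1 0 0 0) (quad 0 0 1 0) (quad 0 0 0 1) (quad 0 0 0 0)"
  "form H11 = mat4 (quad 1 0 0 0) (quad 0 0 0 1) (quad 0 0 (-1) (-1)) (quad 0 1 1 0)"
  "form H12 = mat4 (quad 0 (-1) 0 0) (quad 1 1 0 0) (quad 0 0 0 (-1)) (quad 0 0 1 1)"
  "form (H13 l m) = mat4 (quad 0 1 0 0) (quad m 0 0 0) (quad 0 0 0 1) (quad 0 0 l 0)"
  "form (H14 l) = mat4 (quad 0 1 0 0) (quad l 0 0 0) (quad 0 0 0 (-1)) (quad 0 0 1 1)"
  "form H15 = mat4 (quad 0 1 0 0) (quad 0 0 1 0) (quad 0 0 0 1) (quad 0 0 0 0)"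
  by (rule form4_eqI; simp add: forall_4 form_def alg_struct_def table_struct_def bidx_simps emb_def)+

section \<open>Degenerations along the edges\<close>

definition bil :: "form4 \<Rightarrow> (4 \<Rightarrow> complex) \<Rightarrow> (4 \<Rightarrow> complex) \<Rightarrow> complex" where
  "bil F x y = (\<Sum>a\<in>UNIV. \<Sum>b\<in>UNIV. x a * F (a,b) * y b)"

lemma pull_eq_bil: "pull E F (i,j) = bil F (E i) (E j)"
  by (simp add: pull_def bil_def)

lemma bil_scale:
  "bil F (\<lambda>a. c * x a) y = c * bil F x y" "bil F x (\<lambda>a. c * y a) = c * bil F x y"
  by (simp_all add: bil_def sum_distrib_left mult_ac)

lemma one_plus_eq_0_iff: "1 + l = 0 \<longleftrightarrow> l = (-1 :: 'a :: ring_1)"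
  by (metis add.inverse_inverse add_eq_0_iff)

lemma inverse_one_plus: "l \<noteq> -1 \<Longrightarrow> 1 / (1 + l) + l / (1 + l) = (1 :: complex)"
  by (simp add: one_plus_eq_0_iff flip: add_divide_distrib)

lemma zdeg_exact: "pull E F = G \<Longrightarrow> zdeg F G"
  using zdeg_pull by blast

lemma zdeg_limit4:
  fixes N :: "complex \<Rightarrow> form4"
  assumes "\<And>t. t \<noteq> 0 \<Longrightarrow> \<forall>i j. pull (E t) F (i,j) = N t (i,j)"
    "\<forall>i j. isCont (\<lambda>t. N t (i,j)) 0" "\<forall>i j. N 0 (i,j) = G (i,j)"
  shows "zdeg F G"
proof -
  have "N 0 = G" using assms(3) by auto
  moreover have "pull (E t) F = N t" if "t \<noteq> 0" for t
    using assms(1)[OF that] by auto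
  ultimately show ?thesis using zdeg_limit[of E F N] assms(2) by metis
qed

text \<open>Here \<open>m\<close> is isotropic, \<open>e\<close> is orthogonal to it on both sides,
  and \<open>x\<close>, \<open>y\<close> pair with \<open>m\<close> from one side each. Scaling
  \<open>m\<close> by 1/t and \<open>x\<close>, \<open>y\<close> by t keeps the pairings with
  \<open>m\<close> and lets all other products of \<open>x\<close> and \<open>y\<close> tend to
  0.\<close>

lemma zdeg_H10:
  assumes "bil F m m = 0" "bil F e m = 0" "bil F m e = 0" "bil F e e \<noteq> 0"
    "bil F x m = 1" "bil F m x = 0" "bil F m y = 1" "bil F y m = 0"
  shows "zdeg F (form H10)"
proof -
  define c where "c = csqrt (inverse (bil F e e))"
  have c: "c * (c * bil F e e) = 1"
    using assms(4) by (simp add: c_def flip: mult.assoc power2_eq_square)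
  show ?thesis
  proof (rule zdeg_limit4[where E = "\<lambda>t. quad (\<lambda>a. c * e a) (\<lambda>a. t * x a) (\<lambda>a. inverse t * m a) (\<lambda>a. t * y a)"
        and N = "\<lambda>t. mat4 (quad 1 (t * (c * bil F e x)) 0 (t * (c * bil F e y)))
          (quad (t * (c * bil F x e)) (t\<^sup>2 * bil F x x) 1 (t\<^sup>2 * bil F x y)) (quad 0 0 0 1)
          (quad (t * (c * bil F y e)) (t\<^sup>2 * bil F y x) 0 (t\<^sup>2 * bil F y y))"])
  qed (simp_all add: forall_4 pull_eq_bil bil_scale assms c form_eqs power2_eq_square mult_ac)
qed

text \<open>The scaling argument of \<open>zdeg_H10\<close> without the vector \<open>e\<close>. The
  fourth frame vector is zero, written as a multiple of \<open>m\<close> so that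
  \<open>bil_scale\<close> evaluates it.\<close>

lemma zdeg_H06:
  assumes "bil F m m = 0" "bil F x m = 1" "bil F m x = 0" "bil F m y = 1" "bil F y m = 0"
  shows "zdeg F (form H06)"
proof (rule zdeg_limit4[where E = "\<lambda>t. quad (\<lambda>a. t * x a) (\<lambda>a. inverse t * m a) (\<lambda>a. t * y a) (\<lambda>a. 0 * m a)"
      and N = "\<lambda>t. mat4 (quad (t\<^sup>2 * bil F x x) 1 (t\<^sup>2 * bil F x y) 0) (quad 0 0 1 0)
          (quad (t\<^sup>2 * bil F y x) 0 (t\<^sup>2 * bil F y y) 0) (quad 0 0 0 0)"])
qed (simp_all only: pull_eq_bil forall_4 mat4_simps quad_simps bil_scale,
     simp_all add: assms form_eqs power2_eq_square mult_ac)

lemmas bil_eval = bil_def sum_4 form_eqs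

lemma zdeg_C5: "zdeg F (form C5)"
  by (rule zdeg_exact[of "\<lambda>i a. 0"]) (auto simp: form_eqs pull_def mat4_def quad_def)

text \<open>Both factors must lie on the unit circle and are then conjugate to each other; imaginary
  parts that are both nonnegative force them to be real and equal.\<close>

lemma cle1_mult_eq_1:
  assumes "l \<in> cle1" "m \<in> cle1" "l * m = 1"
  shows "l = m"
proof -
  have "cmod l * cmod m = 1" using assms(3) by (metis norm_mult norm_one)
  moreover have "cmod l \<le> 1" "cmod m \<le> 1" using assms(1,2) by (auto simp: cle1_def)
  ultimately have n: "cmod l = 1" "cmod m = 1"
    by (metis mult.right_neutral mult.left_neutral mult_left_mono mult_right_mono norm_ge_zero order_antisym)+
  then have im: "Im l \<ge> 0" "Im m \<ge> 0" using assms by (auto simp: cle1_def)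
  have "m = cnj l" using n(1) assms(3)
    by (metis complex_norm_square mult.right_neutral mult.assoc mult.commute of_real_1 one_power2)
  then show ?thesis using im by (simp add: complex_eq_iff)
qed

lemmas frame_eval = forall_4 pull_def sum_4 form_eqs

section \<open>A frame, or a curve of frames, for each edge\<close>

lemma edge_H02_H01: "zdeg (form H02) (form H01)"
  by (rule zdeg_exact[of "quad (quad 0 1 0 0) (quad 0 0 0 0) (quad 0 0 0 0) (quad 0 0 0 0)"], rule form4_eqI)
    (simp add: frame_eval)

lemma edge_H02_H03: "zdeg (form H02) (form (H03 (-1)))"
  by (rule zdeg_limit4[of "\<lambda>t. quad (quad (-1/t) 0 0 0) (quad 0 t 0 0) (quad 0 0 0 0) (quad 0 0 0 0)" _
     "\<lambda>t. mat4 (quad 0 1 0 0) (quad (-1) (t^2) 0 0) (quad 0 0 0 0) (quad 0 0 0 0)"])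
    (simp_all add: frame_eval power2_eq_square)

lemma edge_H03_H01: "l \<noteq> -1 \<Longrightarrow> zdeg (form (H03 l)) (form H01)"
  by (rule zdeg_exact[of "quad (quad 1 (1/(1+l)) 0 0) (quad 0 0 0 0) (quad 0 0 0 0) (quad 0 0 0 0)"], rule form4_eqI)
    (simp add: frame_eval inverse_one_plus)

lemma edge_H04_H05: "zdeg (form H04) (form (H05 (-1)))"
  by (rule zdeg_limit4[of "\<lambda>t. quad (quad 1 0 0 0) (quad 0 (-1/t) 0 0) (quad 0 0 t 0) (quad 0 0 0 0)" _
     "\<lambda>t. mat4 (quad 1 0 0 0) (quad 0 0 1 0) (quad 0 (-1) (t^2) 0) (quad 0 0 0 0)"])
    (simp_all add: frame_eval power2_eq_square)

lemma edge_H04_H06: "zdeg (form H04) (form H06)"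
  by (rule zdeg_H06[of _ "quad 1 0 \<i> 0" "quad (1/2) (\<i>/2) 0 0" "quad (1/2) (-\<i>/2) 0 0"])
    (simp_all add: bil_eval)

lemma edge_H05_H06: "l \<noteq> 1 \<Longrightarrow> l \<noteq> -1 \<Longrightarrow> zdeg (form (H05 l)) (form H06)"
  by (rule zdeg_H06[of _ "quad 1 (-1/(1+l)) 1 0" "quad (-l/(1-l)) (1/(1-l)) 0 0" "quad (1/(1-l)) (-1/(1-l)) 0 0"])
    (simp_all add: bil_eval divide_simps one_plus_eq_0_iff)

lemma edge_H05_H03: "zdeg (form (H05 l)) (form (H03 l))"
  by (rule zdeg_exact[of "quad (quad 0 1 0 0) (quad 0 0 1 0) (quad 0 0 0 0) (quad 0 0 0 0)"], rule form4_eqI)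
    (simp add: frame_eval)

lemma edge_H05_H02: "zdeg (form (H05 (-1))) (form H02)"
  by (rule zdeg_exact[of "quad (quad 0 (-1) 0 0) (quad 1 0 1 0) (quad 0 0 0 0) (quad 0 0 0 0)"], rule form4_eqI)
    (simp add: frame_eval)

lemma edge_H06_H02: "zdeg (form H06) (form H02)"
  by (rule zdeg_exact[of "quad (quad (-1) 0 1 0) (quad 1 1 0 0) (quad 0 0 0 0) (quad 0 0 0 0)"], rule form4_eqI)
    (simp add: frame_eval)

lemma edge_H06_H03: "zdeg (form H06) (form (H03 l))"
  by (rule zdeg_exact[of "quad (quad 1 0 l 0) (quad 0 1 0 0) (quad 0 0 0 0) (quad 0 0 0 0)"], rule form4_eqI)
    (simp add: frame_eval)

lemma edge_H07_H05: "zdeg (form H07) (form (H05 1))"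
  by (rule zdeg_limit4[of "\<lambda>t. quad (quad 0 \<i> 0 0) (quad (1/t) 0 0 0) (quad 0 0 t 0) (quad 0 0 0 0)" _
     "\<lambda>t. mat4 (quad 1 0 (-\<i>*t) 0) (quad 0 0 1 0) (quad (\<i>*t) 1 0 0) (quad 0 0 0 0)"])
    (simp_all add: frame_eval)

lemma edge_H07_H06: "zdeg (form H07) (form H06)"
  by (rule zdeg_H06[of _ "quad 0 0 1 0" "quad (1/2) (-1/2) 0 0" "quad (1/2) (1/2) 0 0"])
    (simp_all add: bil_eval)

lemma edge_H08_H10: "zdeg (form H08) (form H10)"
  by (rule zdeg_H10[of _ "quad 0 0 0 1" "quad 0 0 1 0" "quad (-1/2) (1/2) 0 0" "quad (1/2) (1/2) 0 0"])
    (simp_all add: bil_eval)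

lemma edge_H08_H12: "zdeg (form H08) (form H12)"
  by (rule zdeg_limit4[of "\<lambda>t. quad (quad (1/t) 0 0 0) (quad 0 (1/(2*t)) 0 t) (quad 0 \<i> 0 0) (quad (-\<i>/(2*t^2)) 0 \<i> 0)" _
     "\<lambda>t. mat4 (quad 0 (-1) 0 0) (quad 1 1 (\<i>*t) 0) (quad 0 (\<i>*t) 0 (-1)) (quad 0 0 1 1)"])
    (simp_all add: frame_eval power2_eq_square field_simps)

lemma edge_H09_H10:
  assumes "l \<noteq> 1" "l \<noteq> -1"
  shows "zdeg (form (H09 l)) (form H10)"
proof -
  \<comment> \<open>With the isotropic vector \<open>m\<close> supplied at the end,
    \<open>?e\<close> spans the plane orthogonal to \<open>m\<close> on both sides. Its square
    vanishes only for \<open>l\<close> equal to 1 or -1.\<close>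
  let ?e = "quad (-l) (l*l-1) 0 1"
  have "l * l \<noteq> 1" using assms by (auto simp: square_eq_1_iff)
  moreover have "bil (form (H09 l)) ?e ?e = (1 + l) * (l * l - 1)"
    by (simp add: bil_eval algebra_simps)
  ultimately have nz: "bil (form (H09 l)) ?e ?e \<noteq> 0" using assms by (simp add: one_plus_eq_0_iff)
  show ?thesis
    by (rule zdeg_H10[OF _ _ _ nz, of "quad (-1/(1+l)) 1 1 0" "quad 1 (-l) 0 0" "quad 0 1 0 0"])
      (simp_all add: bil_eval divide_simps one_plus_eq_0_iff assms)
qed

text \<open>Scaling e_2 by t and e_4 by 1/t preserves their products with each other and shrinks e_3
  e_2 to zero.\<close>

lemma edge_H09_H13: "zdeg (form (H09 l)) (form (H13 l l))"
  by (rule zdeg_limit4[of "\<lambda>t. quad (quad 1 0 0 0) (quad 0 0 1 0) (quad 0 t 0 0) (quad 0 0 0 (1/t))" _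
     "\<lambda>t. mat4 (quad 0 1 0 0) (quad l 0 t 0) (quad 0 0 0 1) (quad 0 0 l 0)"])
    (simp_all add: frame_eval)

lemma edge_H09_H07: "zdeg (form (H09 1)) (form H07)"
  by (rule zdeg_exact[of "quad (quad 1 0 0 0) (quad 0 2 0 (-1/4)) (quad 0 0 1 (-1/2)) (quad 0 0 0 0)"], rule form4_eqI)
    (simp add: frame_eval)

lemma edge_H10_H04: "zdeg (form H10) (form H04)"
  by (rule zdeg_exact[of "quad (quad 1 0 0 0) (quad 0 (-1) 0 1) (quad 0 1 1 0) (quad 0 0 0 0)"], rule form4_eqI)
    (simp add: frame_eval)

lemma edge_H10_H07: "zdeg (form H10) (form H07)"
  by (rule zdeg_exact[of "quad (quad 0 1 0 1) (quad \<i> (-1) 0 1) (quad 0 0 1 0) (quad 0 0 0 0)"], rule form4_eqI)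
    (simp add: frame_eval)

lemma edge_H10_H05: "zdeg (form H10) (form (H05 l))"
  by (rule zdeg_exact[of "quad (quad 1 0 0 0) (quad 0 1 0 l) (quad 0 0 1 0) (quad 0 0 0 0)"], rule form4_eqI)
    (simp add: frame_eval)

lemma edge_H11_H09: "zdeg (form H11) (form (H09 1))"
  by (rule zdeg_limit4[of "\<lambda>t. quad (quad t 0 (-t) 0) (quad (t/2) 0 (-t/2) (-t)) (quad (1/(2*t)) 0 (1/(2*t)) 0) (quad 0 (-1/t) 0 0)" _
     "\<lambda>t. mat4 (quad 0 (-(t*t)) 1 0) (quad (t*t) 0 0 1) (quad 1 1 0 0) (quad 0 1 0 0)"])
    (simp_all add: frame_eval power2_eq_square field_simps)

lemma edge_H11_H10: "zdeg (form H11) (form H10)"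
  by (rule zdeg_H10[of _ "quad 0 0 0 1" "quad 1 0 0 0" "quad 0 (1/2) (-1/2) 0" "quad 0 (1/2) (1/2) 0"])
    (simp_all add: bil_eval)

lemma edge_H12_H04: "zdeg (form H12) (form H04)"
  by (rule zdeg_exact[of "quad (quad 0 0 0 1) (quad 1 0 0 0) (quad 0 1 0 0) (quad 0 0 0 0)"], rule form4_eqI)
    (simp add: frame_eval)

lemma edge_H12_H14: "zdeg (form H12) (form (H14 (-1)))"
  by (rule zdeg_limit4[of "\<lambda>t. quad (quad (-1/t) 0 0 0) (quad 0 t 0 0) (quad 0 0 1 0) (quad 0 0 0 1)" _
     "\<lambda>t. mat4 (quad 0 1 0 0) (quad (-1) (t^2) 0 0) (quad 0 0 0 (-1)) (quad 0 0 1 1)"])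
    (simp_all add: frame_eval power2_eq_square)

lemma edge_H13_H04:
  assumes "l \<noteq> -1" shows "zdeg (form (H13 l (-1))) (form H04)"
proof -
  \<comment> \<open>Naming the inverse of 1 + l and rewriting every \<open>n * l\<close> to
    \<open>1 - n\<close> removes the divisions from the computation.\<close>
  define n where "n = 1/(1+l)"
  have n: "n * l = 1 - n" using assms by (simp add: n_def field_simps one_plus_eq_0_iff)
  then have n': "l * n = 1 - n" "l * (n * z) = z - n * z" for z
    by (simp_all add: mult.commute) (metis left_diff_distrib mult.assoc mult.commute mult_1)
  show ?thesis
  by (rule zdeg_exact[of "quad (quad (-\<i>*n*(1-l)) 0 \<i> (-\<i>*n)) (quad (-1) 0 0 0) (quad 0 1 1 n) (quad 0 0 0 0)"], rule form4_eqI)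
    (simp add: frame_eval algebra_simps n n')
qed

text \<open>In the first block e_1/(1+l) + e_2 has square 1; the second block is kept
  unchanged.\<close>

lemma edge_H13_H05: "l \<noteq> -1 \<Longrightarrow> zdeg (form (H13 m l)) (form (H05 m))"
  by (rule zdeg_exact[of "quad (quad (1/(1+l)) 1 0 0) (quad 0 0 1 0) (quad 0 0 0 1) (quad 0 0 0 0)"], rule form4_eqI)
    (simp add: frame_eval inverse_one_plus)

text \<open>The square of \<open>?e\<close> is (1+l)(1+m)(1-lm)(l-m), and each hypothesis keeps one
  factor from vanishing.\<close>

lemma edge_H13_H10:
  assumes "l \<noteq> -1" "m \<noteq> -1" "m \<noteq> l" "l * m \<noteq> 1"
  shows "zdeg (form (H13 l m)) (form H10)"
proof -
  have nz: "l - m \<noteq> 0" "1 + l \<noteq> 0" "1 + m \<noteq> 0" "1 - l * m \<noteq> 0" using assms by (auto simp: one_plus_eq_0_iff)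
  let ?m = "quad (1+l) 1 (-(1+m)) 1"
  let ?e = "quad ((1+l)*(1-l*m)) (l-m) (-(1+l)*(1-m*m)) 0"
  \<comment> \<open>The vectors \<open>?x\<close> and \<open>?y\<close> are normalised by
    \<open>d\<close>, and the rule for \<open>d * l\<close> takes the place of division by
    \<open>l - m\<close>.\<close>
  define d where "d = 1 / (l - m)"
  have d: "d * l = 1 + d * m" using nz by (simp add: d_def field_simps)
  have d': "d * (l * z) = z + d * (m * z)" for z
    using d by (metis mult.assoc distrib_right mult_1)
  let ?x = "quad (l * d) 0 (-m * d) 0"
  let ?y = "quad (-d) 0 d 0"
  have "bil (form (H13 l m)) ?e ?e = (1+l)*(1+m)*(1-l*m)*(l-m)"
    by (simp add: bil_eval algebra_simps)
  then have "bil (form (H13 l m)) ?e ?e \<noteq> 0" using nz by simp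
  moreover have "bil (form (H13 l m)) ?x ?m = 1" "bil (form (H13 l m)) ?m ?x = 0"
      "bil (form (H13 l m)) ?y ?m = 0" "bil (form (H13 l m)) ?m ?y = 1"
    by (simp_all add: bil_eval d d' algebra_simps)
  moreover have "bil (form (H13 l m)) ?m ?m = 0" "bil (form (H13 l m)) ?e ?m = 0" "bil (form (H13 l m)) ?m ?e = 0"
    by (simp_all add: bil_eval algebra_simps)
  ultimately show ?thesis by (intro zdeg_H10)
qed

lemma edge_H13_H03: "zdeg (form (H13 l m)) (form (H03 m))"
  by (rule zdeg_exact[of "quad (quad 1 0 0 0) (quad 0 1 0 0) (quad 0 0 0 0) (quad 0 0 0 0)"], rule form4_eqI)
    (simp add: frame_eval)

lemma edge_H14_H05: "zdeg (form (H14 l)) (form (H05 l))"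
  by (rule zdeg_exact[of "quad (quad 0 0 0 1) (quad 1 0 0 0) (quad 0 1 0 0) (quad 0 0 0 0)"], rule form4_eqI)
    (simp add: frame_eval)

lemma edge_H14_H13: "zdeg (form (H14 l)) (form (H13 l (-1)))"
  by (rule zdeg_limit4[of "\<lambda>t. quad (quad 0 0 (-1/t) 0) (quad 0 0 0 t) (quad 1 0 0 0) (quad 0 1 0 0)" _
     "\<lambda>t. mat4 (quad 0 1 0 0) (quad (-1) (t^2) 0 0) (quad 0 0 0 1) (quad 0 0 l 0)"])
    (simp_all add: frame_eval power2_eq_square)

lemma edge_H14_H10:
  assumes "l \<noteq> -1" shows "zdeg (form (H14 l)) (form H10)"
proof -
  define n where "n = 1/(1+l)"
  have n: "n * l = 1 - n" using assms by (simp add: n_def field_simps one_plus_eq_0_iff)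
  then have n': "l * n = 1 - n" "l * (n * z) = z - n * z" for z
    by (simp_all add: mult.commute) (metis left_diff_distrib mult.assoc mult.commute mult_1)
  show ?thesis
  by (rule zdeg_H10[of _ "quad (-n) 1 0 1" "quad (-2*n) 0 (1-2*n) 1" "quad n 0 (n-1) 0" "quad n 0 n 0"])
    (simp_all add: bil_eval algebra_simps n n')
qed

lemma edge_H15_H10: "zdeg (form H15) (form H10)"
  by (rule zdeg_H10[of _ "quad 1 (-1) 1 2" "quad (-1) (-1) 0 1" "quad (-1) 0 0 0" "quad 0 0 0 1"])
    (simp_all add: bil_eval)

lemma edge_H15_H13: "zdeg (form H15) (form (H13 0 0))"
  by (rule zdeg_limit4[of "\<lambda>t. quad (quad (1/t) 0 0 0) (quad 0 t 0 0) (quad 0 0 1 0) (quad 0 0 0 1)" _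
     "\<lambda>t. mat4 (quad 0 1 0 0) (quad 0 0 t 0) (quad 0 0 0 1) (quad 0 0 0 0)"])
    (simp_all add: frame_eval)

lemmas edge_lemmas = edge_H02_H01 edge_H02_H03 edge_H03_H01 zdeg_C5 edge_H04_H05 edge_H04_H06
  edge_H05_H06 edge_H05_H03 edge_H05_H02 edge_H06_H02 edge_H06_H03 edge_H07_H05 edge_H07_H06
  edge_H08_H10 edge_H08_H12 edge_H09_H10 edge_H09_H13 edge_H09_H07 edge_H10_H04 edge_H10_H07
  edge_H10_H05 edge_H11_H09 edge_H11_H10 edge_H12_H04 edge_H12_H14 edge_H13_H04 edge_H13_H05
  edge_H13_H10 edge_H13_H03 edge_H14_H05 edge_H14_H13 edge_H14_H10 edge_H15_H10 edge_H15_H13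

lemma gamma_edge_zdeg:
  assumes "gamma_edge A B"
  shows "zdeg (form A) (form B)"
proof -
  have "edge0 A B" and v: "valid A" using assms by (auto simp: gamma_edge_def)
  then show ?thesis
  proof cases
    \<comment> \<open>Cases 17 and 29, numbered by the rules of \<open>edge0\<close>, are edges to
      \<open>H10\<close> that draw on validity: it excludes -1 for \<open>H09\<close>, and for
      \<open>H13\<close> it excludes \<open>l * m = 1\<close>, which would force
      \<open>l = m\<close>.\<close>
    case (17 l)
    then show ?thesis using v by (auto intro: edge_H09_H10)
  next
    case (29 l m)
    then have "l * m \<noteq> 1" using v cle1_mult_eq_1 by auto
    then show ?thesis using 29 edge_H13_H10 by simp
  qed (simp_all add: edge_lemmas)
qed

lemma path_zdeg:
  assumes "gamma_edge\<^sup>*\<^sup>* A B"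
  shows "zdeg (form A) (form B)"
  using assms
proof induction
  case base
  show ?case by (rule zdeg_exact[OF pull_id])
next
  case (step B C)
  then show ?case using gamma_edge_zdeg zdeg_trans by blast
qed

section \<open>Obstructions\<close>

text \<open>The map \<open>s\<close> selects a principal block, so that blocks of sizes 2, 3 and 4
  are treated together.\<close>

definition pencil_det :: "('k::finite \<Rightarrow> 4) \<Rightarrow> form4 \<Rightarrow> complex \<Rightarrow> complex \<Rightarrow> complex" where
  "pencil_det s N x y = det (\<chi> i j. x * N (s i, s j) + y * N (s j, s i))"

lemma zpoly_pencil_det: "zpoly (\<lambda>N. pencil_det s N x y)"
  unfolding pencil_det_def by (rule zpoly_det) (auto intro!: zpoly_intros)

lemma pencil_pull:
  "x * pull E F (i,j) + y * pull E F (j,i)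
    = (\<Sum>a\<in>UNIV. \<Sum>b\<in>UNIV. E i a * (x * F (a,b) + y * F (b,a)) * E j b)"
proof -
  have "pull E F (j,i) = (\<Sum>a\<in>UNIV. \<Sum>b\<in>UNIV. E i a * F (b,a) * E j b)"
    unfolding pull_def by (subst sum.swap) (simp add: mult_ac)
  then show ?thesis
    by (simp add: pull_def sum_distrib_left distrib_left distrib_right sum.distrib mult_ac)
qed

definition supported_on :: "4 set \<Rightarrow> form4 \<Rightarrow> bool" where
  "supported_on S F \<longleftrightarrow> (\<forall>a b. a \<notin> S \<or> b \<notin> S \<longrightarrow> F (a,b) = 0)"

text \<open>Coordinates outside the block do not meet \<open>F\<close>, so the block of the Gram
  matrix is a congruence by the block of \<open>E\<close>. The resulting square factor is
  independent of \<open>x\<close> and \<open>y\<close>.\<close>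

lemma pencil_det_pull:
  fixes s :: "'k::finite \<Rightarrow> 4"
  assumes "inj s" "supported_on (range s) F"
  shows "pencil_det s (pull E F) x y = (det (\<chi> a i. E (s i) (s a)))\<^sup>2 * pencil_det s F x y"
proof -
  define R :: "complex^'k^'k" where "R = (\<chi> a i. E (s i) (s a))"
  define G where "G a b = x * F (a,b) + y * F (b,a)" for a b
  have G0: "a \<notin> range s \<or> b \<notin> range s \<Longrightarrow> G a b = 0" for a b
    using assms(2) by (auto simp: supported_on_def G_def)
  have red: "(\<Sum>a\<in>UNIV. \<Sum>b\<in>UNIV. E i a * G a b * E j b) = (\<Sum>k\<in>UNIV. \<Sum>l\<in>UNIV. E i (s k) * G (s k) (s l) * E j (s l))" for i j
  proof -
    have "(\<Sum>a\<in>UNIV. \<Sum>b\<in>UNIV. E i a * G a b * E j b) = (\<Sum>a\<in>range s. \<Sum>b\<in>range s. E i a * G a b * E j b)"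
      using G0 by (intro sum.mono_neutral_cong_right) (auto intro!: sum.mono_neutral_right sum.neutral)
    also have "\<dots> = (\<Sum>k\<in>UNIV. \<Sum>l\<in>UNIV. E i (s k) * G (s k) (s l) * E j (s l))"
      using assms(1) by (simp add: sum.reindex)
    finally show ?thesis .
  qed
  have "(transpose R ** (\<chi> i j. G (s i) (s j)) ** R) $ i $ j = x * pull E F (s i, s j) + y * pull E F (s j, s i)" for i j
  proof -
    have "(transpose R ** (\<chi> i j. G (s i) (s j)) ** R) $ i $ j
        = (\<Sum>l\<in>UNIV. \<Sum>k\<in>UNIV. E (s i) (s k) * G (s k) (s l) * E (s j) (s l))"
      by (simp add: matrix_matrix_mult_def transpose_def R_def sum_distrib_right)
    also have "\<dots> = (\<Sum>k\<in>UNIV. \<Sum>l\<in>UNIV. E (s i) (s k) * G (s k) (s l) * E (s j) (s l))"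
      by (rule sum.swap)
    finally show ?thesis unfolding red[symmetric] by (simp only: pencil_pull G_def)
  qed
  then have "(\<chi> i j. x * pull E F (s i, s j) + y * pull E F (s j, s i)) = transpose R ** (\<chi> i j. G (s i) (s j)) ** R"
    by (simp add: vec_eq_iff)
  then have "pencil_det s (pull E F) x y = det (transpose R ** (\<chi> i j. G (s i) (s j)) ** R)"
    by (simp only: pencil_det_def)
  also have "\<dots> = (det R)\<^sup>2 * det (\<chi> i j. G (s i) (s j))"
    by (simp only: det_mul det_transpose power2_eq_square mult_ac)
  finally show ?thesis by (simp only: pencil_det_def R_def G_def)
qed

text \<open>For every frame the determinants at two points carry the same factor. Cross-multiplying
  eliminates it and leaves a polynomial identity that passes to the closure.\<close>

lemma zdeg_pencil_det_ratio:
  fixes s :: "'k::finite \<Rightarrow> 4"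
  assumes "zdeg F G" "inj s" "supported_on (range s) F"
  shows "pencil_det s G x y * pencil_det s F x' y' = pencil_det s G x' y' * pencil_det s F x y"
proof -
  let ?p = "\<lambda>N. pencil_det s N x y * pencil_det s F x' y' - pencil_det s N x' y' * pencil_det s F x y"
  have "?p G = 0"
  proof (rule zdegD[OF assms(1)])
    show "zpoly ?p" by (auto intro!: zpoly_intros zpoly_pencil_det)
    show "?p (pull E F) = 0" for E by (simp add: pencil_det_pull[OF assms(2,3)])
  qed
  then show ?thesis by simp
qed

lemma zdeg_pencil_det_root:
  fixes s :: "'k::finite \<Rightarrow> 4"
  assumes "zdeg F G" "inj s" "supported_on (range s) F" "pencil_det s F x y = 0"
  shows "pencil_det s G x y = 0"
  by (rule zdegD[OF assms(1) zpoly_pencil_det]) (simp add: pencil_det_pull[OF assms(2,3)] assms(4))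

section \<open>Rank of single members of the pencil\<close>

lemma zdeg_pencil_zero:
  assumes "zdeg F G" "\<And>a b. x * F (a,b) + y * F (b,a) = 0"
  shows "x * G (i,j) + y * G (j,i) = 0"
  by (rule zdegD[OF assms(1), of "\<lambda>N. x * N (i,j) + y * N (j,i)"])
    (intro zpoly_intros, simp add: pencil_pull assms(2))

definition lead2 :: "2 \<Rightarrow> 4" where
  "lead2 i = (if i = 1 then 1 else 2)"

definition lead3 :: "3 \<Rightarrow> 4" where
  "lead3 i = (if i = 1 then 1 else if i = 2 then 2 else 3)"

lemma lead2_simps [simp]: "lead2 1 = 1" "lead2 2 = 2"
  by (simp_all add: lead2_def)

lemma lead3_simps [simp]: "lead3 1 = 1" "lead3 2 = 2" "lead3 3 = 3"
  by (simp_all add: lead3_def)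

lemma range_lead [simp]: "range lead2 = {1,2}" "range lead3 = {1,2,3}"
  by (simp_all only: UNIV_2 UNIV_3 image_insert image_empty lead2_simps lead3_simps)

lemma inj_lead [simp]: "inj lead2" "inj lead3"
  by (rule eq_card_imp_inj_on; simp)+

text \<open>A frame turns a product of two linear forms into another such product, so the 2 by 2
  minor vanishes on all Gram matrices and then on the closure.\<close>

lemma zdeg_pencil_rank_le_1:
  assumes "zdeg F G" "\<And>a b. x * F (a,b) + y * F (b,a) = u a * v b"
  shows "pencil_det lead2 G x y = 0"
proof (rule zdegD[OF assms(1) zpoly_pencil_det])
  fix E :: "4 \<Rightarrow> 4 \<Rightarrow> complex"
  define f where "f i = (\<Sum>a\<in>UNIV. E i a * u a)" for i
  define g where "g i = (\<Sum>a\<in>UNIV. v a * E i a)" for i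
  have "x * pull E F (i,j) + y * pull E F (j,i) = f i * g j" for i j
    unfolding pencil_pull assms(2) f_def g_def by (simp add: sum_product mult_ac)
  then show "pencil_det lead2 (pull E F) x y = 0" by (simp add: pencil_det_def det_2)
qed

lemma zdeg_pencil_rank_le_2:
  assumes "zdeg F G" "\<And>a b. x * F (a,b) + y * F (b,a) = u a * v b + w a * z b"
  shows "pencil_det lead3 G x y = 0"
proof (rule zdegD[OF assms(1) zpoly_pencil_det])
  fix E :: "4 \<Rightarrow> 4 \<Rightarrow> complex"
  define f where "f u i = (\<Sum>a\<in>UNIV. E i a * u a)" for i u
  have "x * pull E F (i,j) + y * pull E F (j,i) = f u i * f v j + f w i * f z j" for i j
    unfolding pencil_pull assms(2) f_def by (simp add: sum_product distrib_left distrib_right sum.distrib mult_ac)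
  then show "pencil_det lead3 (pull E F) x y = 0" by (simp add: pencil_det_def det_3 algebra_simps)
qed

lemma det_4:
  "det (A::'a::comm_ring_1^4^4) =
    A$1$1 * (A$2$2 * (A$3$3 * A$4$4 - A$3$4 * A$4$3) - A$2$3 * (A$3$2 * A$4$4 - A$3$4 * A$4$2)
      + A$2$4 * (A$3$2 * A$4$3 - A$3$3 * A$4$2))
    - A$1$2 * (A$2$1 * (A$3$3 * A$4$4 - A$3$4 * A$4$3) - A$2$3 * (A$3$1 * A$4$4 - A$3$4 * A$4$1)
      + A$2$4 * (A$3$1 * A$4$3 - A$3$3 * A$4$1))
    + A$1$3 * (A$2$1 * (A$3$2 * A$4$4 - A$3$4 * A$4$2) - A$2$2 * (A$3$1 * A$4$4 - A$3$4 * A$4$1)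
      + A$2$4 * (A$3$1 * A$4$2 - A$3$2 * A$4$1))
    - A$1$4 * (A$2$1 * (A$3$2 * A$4$3 - A$3$3 * A$4$2) - A$2$2 * (A$3$1 * A$4$3 - A$3$3 * A$4$1)
      + A$2$3 * (A$3$1 * A$4$2 - A$3$2 * A$4$1))"
proof -
  have f1: "finite {2::4, 3, 4}" "1 \<notin> {2::4, 3, 4}"
    and f2: "finite {3::4, 4}" "2 \<notin> {3::4, 4}"
    and f3: "finite {4::4}" "3 \<notin> {4::4}" by auto
  show ?thesis
    unfolding det_def UNIV_4
    unfolding sum_over_permutations_insert[OF f1]
    unfolding sum_over_permutations_insert[OF f2]
    unfolding sum_over_permutations_insert[OF f3]
    unfolding permutes_sing
    by (simp add: sign_swap_id permutation_swap_id permutation_compose sign_compose swap_id_eq)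
      (simp add: algebra_simps)
qed

text \<open>The vector (\<open>k1\<close>, \<open>k2\<close>, \<open>k3\<close>) is read off from
  the skew part of \<open>N\<close> on the first three frame vectors, and \<open>p\<close> is the
  value of the form at it. For \<open>H09 1\<close> this vector is the cross product of the linear
  forms \<open>a\<close> and \<open>b\<close>, and every term of the form contains one of
  them.\<close>

lemma H09_1_cubic:
  assumes "zdeg (form (H09 1)) G"
  defines "p \<equiv> \<lambda>N. let k1 = N (2,3) - N (3,2); k2 = N (3,1) - N (1,3); k3 = N (1,2) - N (2,1) in
    k1*k1*N (1,1) + k2*k2*N (2,2) + k3*k3*N (3,3) + k1*k2*(N (1,2) + N (2,1))
    + k1*k3*(N (1,3) + N (3,1)) + k2*k3*(N (2,3) + N (3,2))"
  shows "p G = 0"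
proof (rule zdegD[OF assms(1)])
  show "zpoly p"
    unfolding p_def Let_def by (intro zpoly_intros)
next
  fix E :: "4 \<Rightarrow> 4 \<Rightarrow> complex"
  let ?N = "pull E (form (H09 1))"
  define a b c d where "a i = E i 3" and "b i = E i 2" and "c i = E i 1" and "d i = E i 4" for i
  have N: "?N (i,j) = c i * a j + a i * c j + b i * d j + d i * b j + a i * b j" for i j
    by (simp add: pull_def sum_4 form_eqs a_def b_def c_def d_def algebra_simps)
  define k1 k2 k3 where "k1 = a 2 * b 3 - a 3 * b 2" and "k2 = a 3 * b 1 - a 1 * b 3" and "k3 = a 1 * b 2 - a 2 * b 1"
  have k: "?N (2,3) - ?N (3,2) = k1" "?N (3,1) - ?N (1,3) = k2" "?N (1,2) - ?N (2,1) = k3"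
    by (simp_all add: N k1_def k2_def k3_def)
  \<comment> \<open>This evaluates a linear form at the cross product, so it annihilates
    \<open>a\<close> and \<open>b\<close>.\<close>
  define ev where "ev f = k1 * f 1 + k2 * f 2 + k3 * f 3" for f :: "4 \<Rightarrow> complex"
  have ab: "ev a = 0" "ev b = 0"
    by (simp_all add: ev_def k1_def k2_def k3_def algebra_simps)
  have "k1*k1*?N (1,1) + k2*k2*?N (2,2) + k3*k3*?N (3,3) + k1*k2*(?N (1,2) + ?N (2,1))
      + k1*k3*(?N (1,3) + ?N (3,1)) + k2*k3*(?N (2,3) + ?N (3,2))
    = 2 * ev c * ev a + 2 * ev b * ev d + ev a * ev b"
    unfolding N ev_def by (simp add: algebra_simps)
  then show "p ?N = 0" by (simp add: p_def k ab)
qed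

section \<open>Comparison of the algebras with the graph\<close>

lemma supported_form:
  "supported_on {1,2} (form C5)" "supported_on {1,2} (form H01)" "supported_on {1,2} (form H02)"
  "supported_on {1,2} (form (H03 l))"
  "supported_on {1,2,3} (form C5)" "supported_on {1,2,3} (form H01)" "supported_on {1,2,3} (form H02)"
  "supported_on {1,2,3} (form (H03 l))" "supported_on {1,2,3} (form H04)" "supported_on {1,2,3} (form (H05 l))"
  "supported_on {1,2,3} (form H06)" "supported_on {1,2,3} (form H07)"
  by (simp_all add: supported_on_def forall_4 form_eqs)

lemma pencil_det_lead2:
  "pencil_det lead2 (form C5) x y = 0"
  "pencil_det lead2 (form H01) x y = 0"
  "pencil_det lead2 (form H02) x y = (x - y)\<^sup>2"
  "pencil_det lead2 (form (H03 l)) x y = - ((x + l * y) * (l * x + y))"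
  by (simp_all add: pencil_det_def det_2 form_eqs power2_eq_square algebra_simps)

lemma pencil_det_lead3:
  "pencil_det lead3 (form C5) x y = 0"
  "pencil_det lead3 (form H01) x y = 0"
  "pencil_det lead3 (form H02) x y = 0"
  "pencil_det lead3 (form (H03 l)) x y = 0"
  "pencil_det lead3 (form H04) x y = (x + y) * (x - y)\<^sup>2"
  "pencil_det lead3 (form (H05 l)) x y = - ((x + y) * (x + l * y) * (l * x + y))"
  "pencil_det lead3 (form H06) x y = 0"
  "pencil_det lead3 (form H07) x y = (x + y) ^ 3"
  by (simp_all add: pencil_det_def det_3 form_eqs power2_eq_square power3_eq_cube algebra_simps)

text \<open>The parameters \<lambda> for which (x + \<lambda>y)(\<lambda>x + y) divides the full
  pencil determinant. The empty set marks the algebras where this determinant vanishes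
  identically.\<close>

fun eigs :: "alg \<Rightarrow> complex set" where
  "eigs H08 = {-1}"
| "eigs (H09 l) = {l}"
| "eigs H11 = {1}"
| "eigs H12 = {-1}"
| "eigs (H13 l m) = {l, m}"
| "eigs (H14 l) = {l, -1}"
| "eigs H15 = {0}"
| "eigs _ = {}"

definition quartic :: "complex \<Rightarrow> complex \<Rightarrow> complex \<Rightarrow> complex \<Rightarrow> complex" where
  "quartic l m x y = (x + l * y) * (l * x + y) * ((x + m * y) * (m * x + y))"

lemma pencil_det_id_singular: "eigs A = {} \<Longrightarrow> pencil_det id (form A) x y = 0"
  by (cases A) (simp_all add: pencil_det_def det_4 form_eqs algebra_simps)

lemma pencil_det_id_regular:
  "pencil_det id (form H08) x y = quartic (-1) (-1) x y"
  "pencil_det id (form (H09 l)) x y = quartic l l x y"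
  "pencil_det id (form H11) x y = quartic 1 1 x y"
  "pencil_det id (form H12) x y = quartic (-1) (-1) x y"
  "pencil_det id (form (H13 l m)) x y = quartic l m x y"
  "pencil_det id (form (H14 l)) x y = quartic l (-1) x y"
  "pencil_det id (form H15) x y = quartic 0 0 x y"
  by (simp_all add: pencil_det_def det_4 form_eqs quartic_def algebra_simps)

lemma pencil_det_id_quartic:
  assumes "eigs A \<noteq> {}"
  obtains l m where "eigs A = {l, m}" "pencil_det id (form A) = quartic l m"
  using assms by (cases A) (force simp: fun_eq_iff pencil_det_id_regular)+

lemma units_in_cle1 [simp]: "0 \<in> cle1" "1 \<in> cle1" "-1 \<in> cle1"
  by (auto simp: cle1_def)

lemma eigs_cle1: "valid A \<Longrightarrow> eigs A \<subseteq> cle1"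
  by (cases A) auto

text \<open>Besides \<open>l\<close> and \<open>m\<close> only their inverses could occur as
  \<open>k\<close>, and \<open>cle1_mult_eq_1\<close> identifies an inverse lying in
  \<open>cle1\<close> with the parameter itself.\<close>

lemma quartic_root_iff:
  assumes "k \<in> cle1" "l \<in> cle1" "m \<in> cle1"
  shows "quartic l m (-k) 1 = 0 \<longleftrightarrow> k \<in> {l, m}"
  using cle1_mult_eq_1[OF assms(2,1)] cle1_mult_eq_1[OF assms(3,1)] by (auto simp: quartic_def)

lemma quartic_nonzero:
  obtains y where "quartic l m 1 y \<noteq> 0"
proof -
  have "infinite (UNIV :: complex set)" by (rule infinite_UNIV_char_0)
  \<comment> \<open>For a zero parameter the quotient is 0 by convention, which merely excludes one
    more value.\<close>
  then obtain y where y: "y \<notin> {-l, -m, -1/l, -1/m}"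
    using ex_new_if_finite by (metis finite.emptyI finite.insertI)
  have "l * y \<noteq> -1" using y by (cases "l = 0") (auto simp: field_simps)
  moreover have "m * y \<noteq> -1" using y by (cases "m = 0") (auto simp: field_simps)
  ultimately have "quartic l m 1 y \<noteq> 0"
    using y by (auto simp: quartic_def add_eq_0_iff)
  then show ?thesis using that by blast
qed

lemma supported_on_UNIV [simp]: "supported_on UNIV F"
  by (simp add: supported_on_def)

text \<open>A nonzero determinant for \<open>B\<close> requires one for \<open>A\<close>; the two
  quartics are then proportional and share their roots in \<open>cle1\<close>.\<close>

lemma zdeg_eigs:
  assumes deg: "zdeg (form A) (form B)" and "valid A" "valid B" "eigs B \<noteq> {}"
  shows "eigs A = eigs B"
proof -
  note ratio = zdeg_pencil_det_ratio[OF deg, of id, simplified]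
    and root = zdeg_pencil_det_root[OF deg, of id, simplified]
  obtain l m where B: "eigs B = {l, m}" "pencil_det id (form B) = quartic l m"
    using pencil_det_id_quartic[OF assms(4)] by metis
  obtain y where y: "quartic l m 1 y \<noteq> 0" using quartic_nonzero by metis
  have "eigs A \<noteq> {}" using root[of 1 y] pencil_det_id_singular B y by auto
  then obtain l' m' where A: "eigs A = {l', m'}" "pencil_det id (form A) = quartic l' m'"
    using pencil_det_id_quartic by metis
  have v: "l \<in> cle1" "m \<in> cle1" "l' \<in> cle1" "m' \<in> cle1"
    using eigs_cle1 assms(2,3) A(1) B(1) by auto
  have "k \<in> eigs B" if "k \<in> eigs A" for k
    using root[of "-k" 1] that v A B quartic_root_iff[of k] by auto
  moreover have "k \<in> eigs A" if "k \<in> eigs B" for k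
  proof -
    have k: "k \<in> cle1" "quartic l m (-k) 1 = 0" using that v B(1) quartic_root_iff[of k l m] by auto
    \<comment> \<open>In the ratio identity the value of the quartic of \<open>B\<close> at (1, y)
      is nonzero and can be cancelled.\<close>
    then have "quartic l' m' (-k) 1 = 0" using ratio[of 1 y "-k" 1] y A(2) B(2) by simp
    then show ?thesis using k v A(1) quartic_root_iff[of k l' m'] by simp
  qed
  ultimately show ?thesis by blast
qed

section \<open>Directed paths in the graph\<close>

abbreviation (input) reaches :: "alg \<Rightarrow> alg \<Rightarrow> bool" where
  "reaches \<equiv> gamma_edge\<^sup>*\<^sup>*"

lemma edge_path: "edge0 A B \<Longrightarrow> valid A \<Longrightarrow> valid B \<Longrightarrow> reaches A B"
  by (auto simp: gamma_edge_def)

text \<open>A target can thus be excluded by excluding any algebra that it reaches.\<close>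

lemma zdeg_then_path: "zdeg (form A) (form B) \<Longrightarrow> reaches B C \<Longrightarrow> zdeg (form A) (form C)"
  using path_zdeg zdeg_trans by blast

lemma path_H01_C5: "reaches H01 C5" by (rule edge_path) (auto intro: edge0.intros)

lemma path_H03: "l \<in> cle1 \<Longrightarrow> reaches (H03 l) C5" "l \<in> cle1 \<Longrightarrow> l \<noteq> -1 \<Longrightarrow> reaches (H03 l) H01"
proof -
  show *: "reaches (H03 l) H01" if "l \<in> cle1" "l \<noteq> -1"
    using that by (intro edge_path) (auto intro: edge0.intros)
  show "reaches (H03 l) C5" if "l \<in> cle1"
  proof (cases "l = -1")
    case True
    then show ?thesis by (auto intro!: edge_path edge0.intros)
  next
    case False
    then show ?thesis using * path_H01_C5 that by (meson rtranclp_trans)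
  qed
qed

lemma path_H02: "reaches H02 H01" "reaches H02 (H03 (-1))" "reaches H02 C5"
proof -
  show *: "reaches H02 H01" by (rule edge_path) (auto intro: edge0.intros)
  then show "reaches H02 C5" using path_H01_C5 by (meson rtranclp_trans)
  show "reaches H02 (H03 (-1))" by (rule edge_path) (auto intro: edge0.intros)
qed

lemma path_H06: "reaches H06 H02" "l \<in> cle1 \<Longrightarrow> reaches H06 (H03 l)" "reaches H06 H01" "reaches H06 C5"
proof -
  show *: "reaches H06 H02" by (rule edge_path) (auto intro: edge0.intros)
  then show "reaches H06 H01" "reaches H06 C5" using path_H02 by (meson rtranclp_trans)+
  show "reaches H06 (H03 l)" if "l \<in> cle1" using that by (intro edge_path) (auto intro: edge0.intros)
qed

text \<open>These are the algebras supported on e_1, e_2, e_3 whose 3 by 3 pencil determinant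
  vanishes identically. They are all reached from \<open>H06\<close>.\<close>

fun low :: "alg \<Rightarrow> bool" where
  "low C5 = True"
| "low H01 = True"
| "low H02 = True"
| "low (H03 l) = True"
| "low H06 = True"
| "low _ = False"

lemma path_H06_low: "valid B \<Longrightarrow> low B \<Longrightarrow> reaches H06 B"
  by (cases B) (auto intro: path_H06)

lemma path_to_H06: "reaches H04 H06" "reaches H07 H06" "reaches H10 H06"
    "l \<in> cle1 \<Longrightarrow> l \<noteq> 1 \<Longrightarrow> l \<noteq> -1 \<Longrightarrow> reaches (H05 l) H06"
proof -
  show *: "reaches H04 H06" by (rule edge_path) (auto intro: edge0.intros)
  have "reaches H10 H04" by (rule edge_path) (auto intro: edge0.intros)
  with * show "reaches H10 H06" by (meson rtranclp_trans)
  show "reaches H07 H06" by (rule edge_path) (auto intro: edge0.intros)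
  show "l \<in> cle1 \<Longrightarrow> l \<noteq> 1 \<Longrightarrow> l \<noteq> -1 \<Longrightarrow> reaches (H05 l) H06"
    by (intro edge_path) (auto intro: edge0.intros)
qed

lemma path_to_low: "reaches A H06 \<Longrightarrow> valid B \<Longrightarrow> low B \<Longrightarrow> reaches A B"
  using path_H06_low by (meson rtranclp_trans)

lemma path_H05_m1: "reaches (H05 (-1)) H02" "reaches (H05 (-1)) H01" "reaches (H05 (-1)) (H03 (-1))" "reaches (H05 (-1)) C5"
proof -
  show *: "reaches (H05 (-1)) H02" by (rule edge_path) (auto intro: edge0.intros)
  then show "reaches (H05 (-1)) H01" "reaches (H05 (-1)) (H03 (-1))" "reaches (H05 (-1)) C5"
    using path_H02 by (meson rtranclp_trans)+
qed

lemma path_H05_1: "reaches (H05 1) (H03 1)" "reaches (H05 1) H01" "reaches (H05 1) C5"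
proof -
  show *: "reaches (H05 1) (H03 1)" by (rule edge_path) (auto intro: edge0.intros)
  then show "reaches (H05 1) H01" "reaches (H05 1) C5"
    using path_H03[of 1] by (auto intro: rtranclp_trans)
qed

lemma path_H10: "reaches H10 H04" "reaches H10 H07" "l \<in> cle1 \<Longrightarrow> reaches H10 (H05 l)"
  by (intro edge_path; auto intro: edge0.intros)+

lemma path_H10_singular: "valid B \<Longrightarrow> eigs B = {} \<Longrightarrow> reaches H10 B"
  by (cases B) (auto intro: path_H10 path_to_low path_to_H06)

lemma path_H04_H05: "reaches H04 (H05 (-1))" and path_H07_H05: "reaches H07 (H05 1)"
  by (intro edge_path; auto intro: edge0.intros)+

lemma path_to_singular: "reaches A H10 \<Longrightarrow> valid B \<Longrightarrow> eigs B = {} \<Longrightarrow> reaches A B"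
  using path_H10_singular by (meson rtranclp_trans)

section \<open>Obstructions between single pairs of algebras\<close>

lemma zdeg_symmetric:
  assumes "zdeg F G" "\<forall>i j. F (i,j) = F (j,i)"
  shows "G (i,j) = G (j,i)"
  using zdeg_pencil_zero[OF assms(1), of 1 "-1" i j] assms(2) by auto

lemma zdeg_skew:
  assumes "zdeg F G" "\<forall>i j. F (i,j) + F (j,i) = 0"
  shows "G (i,j) + G (j,i) = 0"
  using zdeg_pencil_zero[OF assms(1), of 1 1 i j] assms(2) by simp

text \<open>The quantity l/(1+l)^2 determines \<open>l\<close> up to inversion: the difference of
  the two sides is (l-m)(1-lm).\<close>

lemma cle1_ratio:
  assumes "l \<in> cle1" "m \<in> cle1" "l * (1 + m)\<^sup>2 = m * (1 + l)\<^sup>2"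
  shows "l = m"
proof -
  have "(l - m) * (1 - l * m) = 0" using assms(3) by (simp add: power2_eq_square algebra_simps)
  then show ?thesis using cle1_mult_eq_1[OF assms(1,2)] by auto
qed

lemma zdeg_H02_H03: "zdeg (form H02) (form (H03 l)) \<Longrightarrow> l = -1"
  using zdeg_pencil_det_root[of "form H02" "form (H03 l)" lead2 1 1]
  by (simp add: supported_form pencil_det_lead2 one_plus_eq_0_iff add.commute)

lemma zdeg_H03_H03:
  assumes "zdeg (form (H03 l)) (form (H03 m))" "l \<in> cle1" "m \<in> cle1"
  shows "l = m"
proof (rule cle1_ratio[OF assms(2,3)])
  have "- ((1 + m * 1) * (m * 1 + 1)) * - ((1 + l * 0) * (l * 1 + 0))
      = - ((1 + m * 0) * (m * 1 + 0)) * - ((1 + l * 1) * (l * 1 + 1))"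
    using zdeg_pencil_det_ratio[OF assms(1) inj_lead(1), of 1 1 1 0]
    by (simp only: range_lead supported_form pencil_det_lead2 simp_thms)
  then show "l * (1 + m)\<^sup>2 = m * (1 + l)\<^sup>2" by algebra
qed

text \<open>Comparing determinants at (1,1) and (1,0) forces \<open>l = -1\<close>; then the source
  is skew, but e_2 e_2 is nonzero in \<open>H02\<close>.\<close>

lemma zdeg_H03_H02:
  assumes "zdeg (form (H03 l)) (form H02)"
  shows False
proof -
  have "l = -1"
    using zdeg_pencil_det_ratio[OF assms(1), of lead2 1 1 1 0]
    by (simp add: supported_form pencil_det_lead2 one_plus_eq_0_iff add.commute)
  then show False
    using zdeg_skew[OF assms(1), of 2 2] by (simp add: forall_4 form_eqs)
qed

lemma zdeg_H03_m1_H01: "\<not> zdeg (form (H03 (-1))) (form H01)"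
  using zdeg_skew[of "form (H03 (-1))" "form H01" 1 1] by (auto simp: forall_4 form_eqs)

text \<open>The 3 by 3 determinant stays identically zero for everything that \<open>B\<close>
  reaches, which excludes \<open>H04\<close>, \<open>H05\<close>, \<open>H07\<close> and, through
  \<open>H04\<close>, also \<open>H10\<close>. Targets with nonempty \<open>eigs\<close> fail by
  \<open>zdeg_eigs\<close>.\<close>

lemma zdeg_low:
  assumes "zdeg (form A) (form B)" "low A" "valid A" "valid B"
  shows "low B"
proof -
  have s: "supported_on {1,2,3} (form A)" "pencil_det lead3 (form A) x y = 0" for x y
    using assms(2) by (cases A; simp add: supported_form pencil_det_lead3)+
  have p: "pencil_det lead3 (form C) 1 y = 0" if "reaches B C" for C y
    using zdeg_pencil_det_root[OF zdeg_then_path[OF assms(1) that], of lead3] s by simp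
  have "eigs B = {}" using zdeg_eigs[OF assms(1,3,4)] assms(2) by (cases A) auto
  moreover have "B \<noteq> H04" using p[of H04 0] by (auto simp: pencil_det_lead3)
  moreover have "B \<noteq> H10" using p[of H04 0] path_H10 by (auto simp: pencil_det_lead3)
  moreover have "B \<noteq> H07" using p[of H07 0] by (auto simp: pencil_det_lead3)
  \<comment> \<open>The value at (1,0) is -l and the value at (1,1) is -2(1+l)^2; they cannot both
    vanish.\<close>
  moreover have "B \<noteq> H05 l" for l
    using p[of "H05 l" 0] p[of "H05 l" 1] by (auto simp: pencil_det_lead3)
  ultimately show ?thesis by (cases B) auto
qed

lemma zdeg_path_low:
  assumes deg: "zdeg (form A) (form B)" and "low A" "valid A" "valid B"
  shows "reaches A B"
proof -
  have low: "low B" using zdeg_low[OF assms] .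
  have to: "zdeg (form A) (form C)" if "reaches B C" for C
    using zdeg_then_path[OF deg that] .
  \<comment> \<open>Serves the sources \<open>C5\<close> and \<open>H01\<close>, where already the 2
    by 2 determinant vanishes identically.\<close>
  have low2: "B \<noteq> H02" "B \<noteq> H03 l" "B \<noteq> H06"
    if sup: "supported_on {1,2} (form A)" and zero: "\<And>x y. pencil_det lead2 (form A) x y = 0" for l
  proof -
    have p: "pencil_det lead2 (form C) x y = 0" if "reaches B C" for C x y
      using zdeg_pencil_det_root[OF to[OF that], of lead2] sup zero by simp
    show "B \<noteq> H02" using p[of H02 1 0] by (auto simp: pencil_det_lead2)
    show "B \<noteq> H06" using p[of H02 1 0] path_H06 by (auto simp: pencil_det_lead2)
    show "B \<noteq> H03 l" using p[of "H03 l" 1 0] p[of "H03 l" 1 1] by (auto simp: pencil_det_lead2)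
  qed
  show ?thesis
  proof (cases A)
    case C5
    then have "B \<noteq> H01"
      using zdeg_skew[OF deg, of 1 1] by (auto simp: forall_4 form_eqs)
    then show ?thesis using C5 low low2 by (cases B) (auto simp: supported_form pencil_det_lead2)
  next
    case H01
    then show ?thesis using low low2 path_H01_C5 by (cases B) (auto simp: supported_form pencil_det_lead2)
  next
    case H02
    \<comment> \<open>The target \<open>H06\<close> would bring along \<open>H03 0\<close>, whose
      parameter differs from -1.\<close>
    then show ?thesis using low to[of "H03 0"] path_H02 path_H06 deg
      by (cases B) (auto dest: zdeg_H02_H03)
  next
    case (H03 l)
    have "B \<noteq> H02" using deg H03 zdeg_H03_H02 by auto
    moreover have "B \<noteq> H06" using to[of H02] H03 zdeg_H03_H02 path_H06 by auto
    moreover have "l \<noteq> -1" if "B = H01" using that deg H03 zdeg_H03_m1_H01 by auto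
    moreover have "l = m" if "B = H03 m" for m using zdeg_H03_H03 deg that H03 assms(3,4) by auto
    ultimately show ?thesis using H03 low assms(3) path_H03 by (cases B) auto
  next
    case H06
    then show ?thesis using path_H06_low low assms(4) by simp
  qed (use assms(2) in auto)
qed

text \<open>The symmetric part of either source has rank one, while that of \<open>H03 m\<close> has
  determinant proportional to (1+m)^2.\<close>

lemma zdeg_sym_rank_1_H03:
  assumes "zdeg (form A) (form (H03 m))" "A = H05 (-1) \<or> A = H14 (-1)"
  shows "m = -1"
proof -
  have "\<exists>u v. \<forall>a b. form A (a,b) + form A (b,a) = u a * v b"
    using assms(2)
  proof
    assume "A = H05 (-1)"
    then show ?thesis
      by (intro exI[of _ "quad 1 0 0 0"] exI[of _ "quad 2 0 0 0"]) (simp add: forall_4 form_eqs)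
  next
    assume "A = H14 (-1)"
    then show ?thesis
      by (intro exI[of _ "quad 0 0 0 1"] exI[of _ "quad 0 0 0 2"]) (simp add: forall_4 form_eqs)
  qed
  then obtain u v where "\<And>a b. form A (a,b) + form A (b,a) = u a * v b" by metis
  then have "pencil_det lead2 (form (H03 m)) 1 1 = 0"
    by (intro zdeg_pencil_rank_le_1[OF assms(1), of 1 1 u v]) simp
  then show ?thesis by (simp add: pencil_det_lead2 one_plus_eq_0_iff add.commute)
qed

text \<open>The symmetric part of the source has rank at most two, while that of
  \<open>H05 m\<close> has determinant proportional to (1+m)^2.\<close>

lemma zdeg_sym_rank_2_H05:
  assumes "zdeg (form A) (form (H05 m))" "A = H12 \<or> A = H13 l (-1)"
  shows "m = -1"
proof -
  have "\<exists>u v w z. \<forall>a b. form A (a,b) + form A (b,a) = u a * v b + w a * z b"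
    using assms(2)
  proof
    assume "A = H12"
    then show ?thesis
      by (intro exI[of _ "quad 0 1 0 0"] exI[of _ "quad 0 2 0 0"] exI[of _ "quad 0 0 0 1"] exI[of _ "quad 0 0 0 2"])
        (simp add: forall_4 form_eqs)
  next
    assume "A = H13 l (-1)"
    then show ?thesis
      by (intro exI[of _ "quad 0 0 1 0"] exI[of _ "quad 0 0 0 (1+l)"] exI[of _ "quad 0 0 0 1"] exI[of _ "quad 0 0 (1+l) 0"])
        (simp add: forall_4 form_eqs)
  qed
  then obtain u v w z where "\<And>a b. form A (a,b) + form A (b,a) = u a * v b + w a * z b" by metis
  then have "pencil_det lead3 (form (H05 m)) 1 1 = 0"
    by (intro zdeg_pencil_rank_le_2[OF assms(1), of 1 1 u v w z]) simp
  then show ?thesis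
    by (simp add: pencil_det_lead3 one_plus_eq_0_iff add.commute del: distrib_left_numeral)
qed

text \<open>At (l, -1) each block of the source drops to rank at most one. For \<open>H05 m\<close>
  the determinant there is -(l-1)(l-m)(lm-1).\<close>

lemma zdeg_H13_diag_H05:
  assumes "zdeg (form (H13 l l)) (form (H05 m))" "l \<in> cle1" "m \<in> cle1" "l \<noteq> 1"
  shows "m = l"
proof -
  have "l * form (H13 l l) (a,b) + (-1) * form (H13 l l) (b,a)
      = quad 0 1 0 0 a * quad (l*l-1) 0 0 0 b + quad 0 0 0 1 a * quad 0 0 (l*l-1) 0 b" for a b
  proof -
    have "\<forall>a b. l * form (H13 l l) (a,b) + (-1) * form (H13 l l) (b,a)
      = quad 0 1 0 0 a * quad (l*l-1) 0 0 0 b + quad 0 0 0 1 a * quad 0 0 (l*l-1) 0 b"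
      by (simp add: forall_4 form_eqs)
    then show ?thesis by blast
  qed
  then have "pencil_det lead3 (form (H05 m)) l (-1) = 0"
    by (rule zdeg_pencil_rank_le_2[OF assms(1)])
  then show ?thesis using assms(4) cle1_mult_eq_1[OF assms(3,2)] by (auto simp: pencil_det_lead3)
qed

text \<open>On \<open>H05 m\<close> the cubic takes the value (1-m)^2.\<close>

lemma zdeg_H09_1_H05:
  assumes "zdeg (form (H09 1)) (form (H05 m))"
  shows "m = 1"
  using H09_1_cubic[OF assms] by (simp add: form_eqs Let_def)

lemma zdeg_H05_H05:
  assumes "zdeg (form (H05 l)) (form (H05 m))" "l \<in> cle1" "m \<in> cle1"
  shows "l = m"
proof (rule cle1_ratio[OF assms(2,3)])
  have "- ((1 + 1) * (1 + m * 1) * (m * 1 + 1)) * - ((1 + 0) * (1 + l * 0) * (l * 1 + 0))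
      = - ((1 + 0) * (1 + m * 0) * (m * 1 + 0)) * - ((1 + 1) * (1 + l * 1) * (l * 1 + 1))"
    using zdeg_pencil_det_ratio[OF assms(1) inj_lead(2), of 1 1 1 0]
    by (simp only: range_lead supported_form pencil_det_lead3 simp_thms)
  then have "2 * (l * (1 + m)\<^sup>2) = 2 * (m * (1 + l)\<^sup>2)" by algebra
  then show "l * (1 + m)\<^sup>2 = m * (1 + l)\<^sup>2" by simp
qed

lemma zdeg_H04_H05:
  assumes "zdeg (form H04) (form (H05 m))"
  shows "m = -1"
  using zdeg_pencil_det_root[OF assms inj_lead(2), of 1 1]
  by (simp add: supported_form pencil_det_lead3 one_plus_eq_0_iff add.commute del: distrib_left_numeral)

lemma zdeg_H04_H07: "\<not> zdeg (form H04) (form H07)"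
proof
  assume "zdeg (form H04) (form H07)"
  from zdeg_pencil_det_root[OF this inj_lead(2), of 1 1] show False
    by (simp add: supported_form pencil_det_lead3)
qed

lemma zdeg_H07_H04: "\<not> zdeg (form H07) (form H04)"
proof
  assume "zdeg (form H07) (form H04)"
  from zdeg_pencil_det_ratio[OF this inj_lead(2), of 1 1 1 0] show False
    by (simp add: supported_form pencil_det_lead3)
qed

text \<open>The determinant of \<open>H07\<close> has ratio 8 between (1,1) and (1,0); this is the
  equation it imposes on the parameter of \<open>H05\<close>.\<close>

lemma eq_1_of_ratio_8: "8 * m = 2 * (1 + m)\<^sup>2 \<Longrightarrow> m = (1 :: complex)"
proof -
  assume "8 * m = 2 * (1 + m)\<^sup>2"
  then have "2 * ((m - 1) * (m - 1)) = 0" by algebra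
  then show "m = 1" by simp
qed

lemma zdeg_H07_H05:
  assumes "zdeg (form H07) (form (H05 m))"
  shows "m = 1"
proof (rule eq_1_of_ratio_8)
  have cubes: "(1 + 0) ^ 3 = (1 :: complex)" "(1 + 1) ^ 3 = (8 :: complex)" by simp_all
  have "- ((1 + 1) * (1 + m * 1) * (m * 1 + 1)) * 1 = - ((1 + 0) * (1 + m * 0) * (m * 1 + 0)) * 8"
    using zdeg_pencil_det_ratio[OF assms(1) inj_lead(2), of 1 1 1 0]
    by (simp only: range_lead supported_form pencil_det_lead3 simp_thms cubes)
  then show "8 * m = 2 * (1 + m)\<^sup>2" by algebra
qed

lemma zdeg_H05_H04: "\<not> zdeg (form (H05 l)) (form H04)"
proof
  assume deg: "zdeg (form (H05 l)) (form H04)"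
  have "l = -1"
    using zdeg_pencil_det_ratio[OF deg inj_lead(2), of 1 1 1 0]
    by (simp add: supported_form pencil_det_lead3 one_plus_eq_0_iff add.commute del: distrib_left_numeral)
  \<comment> \<open>From \<open>H04\<close> one continues through \<open>H06\<close> to
    \<open>H03 0\<close>, against the rank-one bound for \<open>H05 (-1)\<close>.\<close>
  moreover have "zdeg (form (H05 l)) (form (H03 0))"
    using zdeg_then_path[OF deg] path_to_H06(1) path_H06(2)[of 0] by (meson rtranclp_trans units_in_cle1)
  ultimately show False using zdeg_sym_rank_1_H03[of "H05 l" 0] by simp
qed

text \<open>The determinant ratio forces \<open>l = 1\<close>, where the source is symmetric but
  \<open>H07\<close> is not.\<close>

lemma zdeg_H05_H07: "\<not> zdeg (form (H05 l)) (form H07)"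
proof
  assume deg: "zdeg (form (H05 l)) (form H07)"
  have cubes: "(1 + 0) ^ 3 = (1 :: complex)" "(1 + 1) ^ 3 = (8 :: complex)" by simp_all
  have "8 * - ((1 + 0) * (1 + l * 0) * (l * 1 + 0)) = 1 * - ((1 + 1) * (1 + l * 1) * (l * 1 + 1))"
    using zdeg_pencil_det_ratio[OF deg inj_lead(2), of 1 1 1 0]
    by (simp only: range_lead supported_form pencil_det_lead3 simp_thms cubes)
  then have "8 * l = 2 * (1 + l)\<^sup>2" by algebra
  then have "l = 1" by (rule eq_1_of_ratio_8)
  then show False using zdeg_symmetric[OF deg, of 2 3] by (simp add: forall_4 form_eqs)
qed

section \<open>Targets of \<open>H05\<close>, \<open>H04\<close> and \<open>H07\<close>\<close>

lemma singular_cases: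
  assumes "eigs B = {}"
  obtains "low B" | "B = H04" | l where "B = H05 l" | "B = H07" | "B = H10"
  using assms by (cases B) auto

lemma zdeg_path_H05:
  assumes deg: "zdeg (form (H05 l)) (form B)" and v: "l \<in> cle1" "valid B"
  shows "reaches (H05 l) B"
proof -
  have to: "zdeg (form (H05 l)) (form C)" if "reaches B C" for C
    using zdeg_then_path[OF deg that] .
  have "eigs B = {}" using zdeg_eigs[OF deg] v by auto
  then show ?thesis
  proof (cases rule: singular_cases)
    case 1
    consider "l = 1" | "l = -1" | "l \<noteq> 1" "l \<noteq> -1" by blast
    then show ?thesis
    proof cases
      case one: 1
      then have "\<forall>i j. form B (i,j) = form B (j,i)"
        using zdeg_symmetric[OF deg] by (simp add: forall_4 form_eqs)
      then show ?thesis using 1 one path_H05_1 by (cases B) (simp_all add: forall_4 form_eqs)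
    next
      case m1: 2
      have "m = -1" if "reaches B (H03 m)" for m
        using zdeg_sym_rank_1_H03[OF to[OF that]] m1 by simp
      \<comment> \<open>\<open>H06\<close> reaches \<open>H03 0\<close>, whose parameter is not
        -1.\<close>
      moreover have "B \<noteq> H06" using calculation[of 0] path_H06 by auto
      ultimately show ?thesis using 1 m1 path_H05_m1 by (cases B) auto
    next
      case 3
      then show ?thesis using path_to_low path_to_H06 1 v by blast
    qed
  next
    case 2
    then show ?thesis using deg zdeg_H05_H04 by simp
  next
    case (3 m)
    then show ?thesis using deg zdeg_H05_H05 v by auto
  next
    case 4
    then show ?thesis using deg zdeg_H05_H07 by simp
  next
    case 5
    then show ?thesis using to[of H04] path_H10 zdeg_H05_H04 by simp
  qed
qed

lemma zdeg_path_H04_H07: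
  assumes deg: "zdeg (form A) (form B)" and A: "A = H04 \<or> A = H07" and v: "valid B"
  shows "reaches A B"
proof -
  have to: "zdeg (form A) (form C)" if "reaches B C" for C
    using zdeg_then_path[OF deg that] .
  have "eigs B = {}" using zdeg_eigs[OF deg] v A by force
  then show ?thesis
  proof (cases rule: singular_cases)
    case 1
    then show ?thesis using path_to_low path_to_H06 A v by blast
  next
    case 2
    then show ?thesis using deg zdeg_H07_H04 A by auto
  next
    case (3 m)
    then show ?thesis using deg zdeg_H04_H05 zdeg_H07_H05 A path_H04_H05 path_H07_H05 by auto
  next
    case 4
    then show ?thesis using deg zdeg_H04_H07 A by auto
  next
    case 5
    then show ?thesis using to[of H04] to[of H07] path_H10 zdeg_H04_H07 zdeg_H07_H04 A by auto
  qed
qed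

section \<open>Targets of the algebras with nonzero pencil determinant\<close>

lemma path_to_H10: "reaches H08 H10" "l \<in> cle1 \<Longrightarrow> l \<noteq> 1 \<Longrightarrow> l \<noteq> -1 \<Longrightarrow> l \<noteq> 0 \<Longrightarrow> reaches (H09 l) H10"
  "reaches H11 H10" "l \<in> cle1 \<Longrightarrow> l \<noteq> -1 \<Longrightarrow> reaches (H14 l) H10" "reaches H15 H10"
  "valid (H13 l m) \<Longrightarrow> l \<noteq> -1 \<Longrightarrow> m \<noteq> -1 \<Longrightarrow> l \<noteq> m \<Longrightarrow> reaches (H13 l m) H10"
  by (intro edge_path; auto intro: edge0.intros)+

lemma path_to_H05: "reaches A H10 \<Longrightarrow> l \<in> cle1 \<Longrightarrow> reaches A (H05 l)"
  using path_H10 by (meson rtranclp_trans)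

lemma cge0_0 [simp]: "0 \<in> cge0"
  by (simp add: cge0_def)

lemma cge0_antisym: "l - m \<in> cge0 \<Longrightarrow> m - l \<in> cge0 \<Longrightarrow> l = m"
  by (auto simp: cge0_def complex_eq_iff)

text \<open>The real part is at least -1, with equality in the unit disc only at -1 itself. Hence -1
  is always admissible as the second parameter of \<open>H13\<close>.\<close>

lemma cle1_cge0: "l \<in> cle1 \<Longrightarrow> l + 1 \<in> cge0"
proof -
  assume l: "l \<in> cle1"
  then have n: "cmod l \<le> 1" by (auto simp: cle1_def)
  then have "\<bar>Re l\<bar> \<le> 1" using abs_Re_le_cmod order_trans by blast
  moreover have "Im l = 0" if "Re l = -1"
  proof -
    have "(Re l)\<^sup>2 + (Im l)\<^sup>2 \<le> 1" using n by (simp add: cmod_def)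
    then show ?thesis using that by simp
  qed
  ultimately show ?thesis by (auto simp: cge0_def)
qed

lemma valid_H13_m1: "valid (H13 (-1) m) \<Longrightarrow> m = -1"
  using cle1_cge0[of m] cge0_antisym[of "-1" m] by (simp add: add.commute)

lemma path_regular: "reaches H08 H12" "reaches H12 (H14 (-1))" "l \<in> cle1 \<Longrightarrow> reaches (H14 l) (H13 l (-1))"
  "reaches H12 H04" "reaches (H14 (-1)) (H05 (-1))" "reaches H11 (H09 1)" "reaches (H09 1) H07"
  "l \<in> cle1 \<Longrightarrow> l \<noteq> -1 \<Longrightarrow> l \<noteq> 0 \<Longrightarrow> reaches (H09 l) (H13 l l)" "reaches H15 (H13 0 0)"
  "l \<in> cle1 \<Longrightarrow> l \<noteq> -1 \<Longrightarrow> reaches (H13 l (-1)) H04" "l \<in> cle1 \<Longrightarrow> l \<noteq> -1 \<Longrightarrow> reaches (H13 l l) (H05 l)"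
  "reaches (H13 (-1) (-1)) (H03 (-1))"
proof -
  show "reaches (H14 l) (H13 l (-1))" if "l \<in> cle1"
    using that cle1_cge0[OF that] by (cases "l = -1") (auto intro!: edge_path edge0.intros)
  show "reaches (H13 l (-1)) H04" if "l \<in> cle1" "l \<noteq> -1"
    using that cle1_cge0 by (auto intro!: edge_path edge0.intros)
qed (auto intro!: edge_path edge0.intros)

lemma path_m1: "reaches H08 (H14 (-1))" "reaches H08 (H13 (-1) (-1))" "reaches H12 (H13 (-1) (-1))" "reaches H11 (H13 1 1)"
proof -
  show 1: "reaches H12 (H13 (-1) (-1))"
    using path_regular(2) path_regular(3)[of "-1"] by (meson rtranclp_trans units_in_cle1)
  show "reaches H08 (H14 (-1))" using path_regular(1,2) by (meson rtranclp_trans)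
  show "reaches H08 (H13 (-1) (-1))" using path_regular(1) 1 by (meson rtranclp_trans)
  have "reaches (H09 1) (H13 1 1)" using path_regular(8)[of 1] by simp
  then show "reaches H11 (H13 1 1)" using path_regular(6) by (meson rtranclp_trans)
qed

text \<open>\<open>H10\<close> reaches every algebra with empty \<open>eigs\<close>, so for sources
  above it only targets with the same nonempty set remain to be checked.\<close>

lemma zdeg_path_H10:
  assumes "zdeg (form A) (form B)" "valid A" "valid B" "reaches A H10"
    "\<And>C. valid C \<Longrightarrow> eigs C \<noteq> {} \<Longrightarrow> eigs A = eigs C \<Longrightarrow> reaches A C"
  shows "reaches A B"
  using zdeg_eigs[OF assms(1-3)] assms(3-5) path_to_singular by blast

text \<open>The rank bound on the symmetric part leaves \<open>H05 (-1)\<close> as the only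
  \<open>H05\<close> below \<open>B\<close>. This excludes \<open>H07\<close> and everything that
  reaches \<open>H10\<close>.\<close>

lemma zdeg_path_H12_H13:
  assumes deg: "zdeg (form A) (form B)" and A: "A = H12 \<or> A = H13 l (-1) \<and> l \<noteq> -1" and v: "valid A" "valid B"
  shows "reaches A B"
proof -
  have H05: "m = -1" if "reaches B (H05 m)" for m
    using zdeg_sym_rank_2_H05[OF zdeg_then_path[OF deg that]] A by auto
  have H10: "\<not> reaches B H10" using H05[of 1] path_to_H05[of B 1] by auto
  have H04: "reaches A H04" using A v path_regular by auto
  show ?thesis
  proof (cases "eigs B = {}")
    case True
    then show ?thesis
    proof (cases rule: singular_cases)
      case 1
      then show ?thesis using H04 path_to_H06(1) path_to_low v by (meson rtranclp_trans)
    next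
      case 2
      then show ?thesis using H04 by simp
    next
      case (3 m)
      then show ?thesis using H05 H04 path_H04_H05 by (metis rtranclp.rtrancl_refl rtranclp_trans)
    next
      case 4
      then show ?thesis using H05[of 1] path_H07_H05 by auto
    next
      case 5
      then show ?thesis using H10 by auto
    qed
  next
    case False
    then have e: "eigs A = eigs B" using zdeg_eigs[OF deg v] by simp
    from A show ?thesis
    proof
      assume A: "A = H12"
      then show ?thesis using e v H10 path_to_H10 path_regular path_m1
        by (cases B) (auto simp: doubleton_eq_iff singleton_insert_inj_eq)
    next
      assume A: "A = H13 l (-1) \<and> l \<noteq> -1"
      then show ?thesis using e v H10 path_to_H10 valid_H13_m1
        by (cases B) (auto simp: doubleton_eq_iff singleton_insert_inj_eq)
    qed
  qed
qed

text \<open>The symmetric part of rank one leaves \<open>H03 (-1)\<close> as the only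
  \<open>H03\<close> below \<open>B\<close>, so \<open>B\<close> lies above neither
  \<open>H06\<close> nor \<open>H04\<close>.\<close>

lemma zdeg_path_H14_m1:
  assumes deg: "zdeg (form (H14 (-1))) (form B)" and v: "valid B"
  shows "reaches (H14 (-1)) B"
proof -
  have H03: "m = -1" if "reaches B (H03 m)" for m
    using zdeg_sym_rank_1_H03[OF zdeg_then_path[OF deg that]] by auto
  have H06: "\<not> reaches B H06" using path_H06(2)[of 0] H03[of 0] rtranclp_trans[of gamma_edge B H06 "H03 0"] by auto
  then have H04: "\<not> reaches B H04" using path_to_H06(1) by (meson rtranclp_trans)
  have H05: "reaches (H14 (-1)) (H05 (-1))" by (rule path_regular)
  show ?thesis
  proof (cases "eigs B = {}")
    case True
    then show ?thesis
    proof (cases rule: singular_cases)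
      case 1
      then show ?thesis using H03 H06 H05 path_H05_m1
        by (cases B) (auto intro: rtranclp_trans)
    next
      case 2
      then show ?thesis using H04 by simp
    next
      case (3 m)
      have "m = -1" using H03[of 1] H06 path_H05_1 path_to_H06(4) 3 v by auto
      then show ?thesis using 3 H05 by simp
    next
      case 4
      then show ?thesis using H06 path_to_H06 by auto
    next
      case 5
      then show ?thesis using H06 path_to_H06 by auto
    qed
  next
    case False
    then have e: "eigs B = {-1}" using zdeg_eigs[OF deg] v by simp
    \<comment> \<open>Among the algebras with set {-1}, both \<open>H08\<close> and
      \<open>H12\<close> lie above \<open>H04\<close> and drop out; \<open>H14 (-1)\<close> and
      \<open>H13 (-1) (-1)\<close> remain.\<close>
    have "reaches H08 H04" using path_regular by (meson rtranclp_trans)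
    then show ?thesis using e v H04 path_regular
      by (cases B) (auto simp: doubleton_eq_iff singleton_insert_inj_eq)
  qed
qed

lemma zdeg_path_H13_1:
  assumes deg: "zdeg (form (H13 1 1)) (form B)" and v: "valid B"
  shows "reaches (H13 1 1) B"
proof -
  have "\<forall>i j. form B (i,j) = form B (j,i)"
    using zdeg_symmetric[OF deg] by (simp add: forall_4 form_eqs)
  moreover have H05: "reaches (H13 1 1) (H05 1)" using path_regular(11)[of 1] by simp
  moreover have "reaches (H13 1 1) (H03 1)" "reaches (H13 1 1) H01" "reaches (H13 1 1) C5"
    using H05 path_H05_1 by (meson rtranclp_trans)+
  moreover have "eigs B \<noteq> {} \<Longrightarrow> eigs B = {1}" using zdeg_eigs[OF deg] v by simp
  ultimately show ?thesis
    by (cases B) (auto simp: forall_4 form_eqs doubleton_eq_iff singleton_insert_inj_eq)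
qed

lemma zdeg_path_H13_m1:
  assumes deg: "zdeg (form (H13 (-1) (-1))) (form B)" and v: "valid B"
  shows "reaches (H13 (-1) (-1)) B"
proof -
  have "\<forall>i j. form B (i,j) + form B (j,i) = 0"
    using zdeg_skew[OF deg] by (simp add: forall_4 form_eqs)
  moreover have H03: "reaches (H13 (-1) (-1)) (H03 (-1))" by (rule path_regular)
  moreover have "reaches (H13 (-1) (-1)) C5" using H03 path_H03(1)[of "-1"] by (meson rtranclp_trans units_in_cle1)
  ultimately show ?thesis
    by (cases B) (auto simp: forall_4 form_eqs one_plus_eq_0_iff)
qed

text \<open>Only \<open>H05 l\<close> may lie below \<open>B\<close>. Since \<open>H04\<close> and
  \<open>H07\<close> reach \<open>H05\<close> with parameter -1 and 1, and \<open>H10\<close>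
  reaches all of them, these three are excluded.\<close>

lemma zdeg_path_H13_diag:
  assumes deg: "zdeg (form (H13 l l)) (form B)" and v: "l \<in> cle1" "l \<noteq> 1" "l \<noteq> -1" "valid B"
  shows "reaches (H13 l l) B"
proof -
  have H05: "m = l" if "reaches B (H05 m)" "m \<in> cle1" for m
    using zdeg_H13_diag_H05[OF zdeg_then_path[OF deg that(1)]] v that by auto
  have H10: "\<not> reaches B H10" using H05[of 1] path_to_H05[of B 1] v by auto
  have A: "reaches (H13 l l) (H05 l)" using path_regular v by simp
  show ?thesis
  proof (cases "eigs B = {}")
    case True
    then show ?thesis
    proof (cases rule: singular_cases)
      case 1
      then show ?thesis using A path_to_H06(4) path_to_low v by (meson rtranclp_trans)
    next
      case 2
      then show ?thesis using H05[of "-1"] path_H04_H05 v by simp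
    next
      case (3 m)
      then show ?thesis using H05[of m] v A by auto
    next
      case 4
      then show ?thesis using H05[of 1] path_H07_H05 v by simp
    next
      case 5
      then show ?thesis using H10 by auto
    qed
  next
    case False
    then have e: "eigs B = {l}" using zdeg_eigs[OF deg] v by simp
    then show ?thesis using v H10 path_to_H10
      by (cases B) (auto simp: doubleton_eq_iff singleton_insert_inj_eq)
  qed
qed

text \<open>The cubic leaves \<open>H05 1\<close> as the only \<open>H05\<close> below
  \<open>B\<close>, which excludes \<open>H04\<close>, \<open>H10\<close> and, through
  \<open>H10\<close>, also \<open>H11\<close>.\<close>

lemma zdeg_path_H09_1:
  assumes deg: "zdeg (form (H09 1)) (form B)" and v: "valid B"
  shows "reaches (H09 1) B"
proof -
  have H05: "m = 1" if "reaches B (H05 m)" for m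
    using zdeg_H09_1_H05[OF zdeg_then_path[OF deg that(1)]] .
  have H10: "\<not> reaches B H10" using H05[of 0] path_to_H05[of B 0] by auto
  have H07: "reaches (H09 1) H07" by (rule path_regular)
  show ?thesis
  proof (cases "eigs B = {}")
    case True
    then show ?thesis
    proof (cases rule: singular_cases)
      case 1
      then show ?thesis using H07 path_to_H06(2) path_to_low v by (meson rtranclp_trans)
    next
      case 2
      then show ?thesis using H05[of "-1"] path_H04_H05 by simp
    next
      case (3 m)
      then show ?thesis using H05[of m] H07 path_H07_H05 by (metis rtranclp.rtrancl_refl rtranclp_trans)
    next
      case 4
      then show ?thesis using H07 by simp
    next
      case 5
      then show ?thesis using H10 by auto
    qed
  next
    case False
    then have e: "eigs B = {1}" using zdeg_eigs[OF deg] v by simp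
    then show ?thesis using v H10 path_to_H10 path_regular(8)[of 1]
      by (cases B) (auto simp: doubleton_eq_iff singleton_insert_inj_eq)
  qed
qed

text \<open>Sources above \<open>H10\<close> are settled by comparing \<open>eigs\<close>; each of
  the others has its own obstruction.\<close>

lemma zdeg_imp_path:
  assumes deg: "zdeg (form A) (form B)" and v: "valid A" "valid B"
  shows "reaches A B"
proof (cases A)
  case H10
  then show ?thesis using path_H10_singular zdeg_eigs[OF deg v] v by auto
next
  case (H05 l)
  then show ?thesis using zdeg_path_H05 deg v by simp
next
  case H08
  show ?thesis
  proof (rule zdeg_path_H10[OF deg v])
    fix C assume "valid C" "eigs C \<noteq> {}" "eigs A = eigs C"
    then show "reaches A C" using H08 path_regular path_m1
      by (cases C) (auto simp: doubleton_eq_iff singleton_insert_inj_eq)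
  qed (use H08 path_to_H10 in auto)
next
  case (H09 l)
  show ?thesis
  proof (cases "l = 1")
    case True
    then show ?thesis using zdeg_path_H09_1 H09 deg v by simp
  next
    case False
    show ?thesis
    proof (rule zdeg_path_H10[OF deg v])
      fix C assume "valid C" "eigs C \<noteq> {}" "eigs A = eigs C"
      then show "reaches A C" using H09 False v path_regular
        by (cases C) (auto simp: doubleton_eq_iff singleton_insert_inj_eq)
    qed (use H09 False v path_to_H10 in auto)
  qed
next
  case H11
  show ?thesis
  proof (rule zdeg_path_H10[OF deg v])
    fix C assume "valid C" "eigs C \<noteq> {}" "eigs A = eigs C"
    then show "reaches A C" using H11 path_regular path_m1
      by (cases C) (auto simp: doubleton_eq_iff singleton_insert_inj_eq)
  qed (use H11 path_to_H10 in auto)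
next
  case (H13 l m)
  \<comment> \<open>A first parameter -1 forces the second to be -1, so these five cases are
    exhaustive.\<close>
  consider "m = -1" "l \<noteq> -1" | "l = -1" "m = -1" | "l = m" "l = 1" | "l = m" "l \<noteq> 1" "l \<noteq> -1"
    | "l \<noteq> m" "l \<noteq> -1" "m \<noteq> -1"
    using valid_H13_m1 v H13 by auto
  then show ?thesis
  proof cases
    case 1
    then show ?thesis using zdeg_path_H12_H13[OF deg] H13 v by simp
  next
    case 2
    then show ?thesis using zdeg_path_H13_m1 deg H13 v by simp
  next
    case 3
    then show ?thesis using zdeg_path_H13_1 deg H13 v by simp
  next
    case 4
    then show ?thesis using zdeg_path_H13_diag deg H13 v by simp
  next
    case 5
    show ?thesis
    proof (rule zdeg_path_H10[OF deg v])
      \<comment> \<open>Two distinct parameters other than -1 occur only in \<open>H13\<close>, and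
        the condition on \<open>l - m\<close> fixes their order, so \<open>C\<close> is
        \<open>A\<close> itself.\<close>
      fix C assume "valid C" "eigs C \<noteq> {}" "eigs A = eigs C"
      then show "reaches A C" using H13 5 v cge0_antisym
        by (cases C) (auto simp: doubleton_eq_iff singleton_insert_inj_eq)
    qed (use H13 5 v path_to_H10 in auto)
  qed
next
  case (H14 l)
  show ?thesis
  proof (cases "l = -1")
    case True
    then show ?thesis using zdeg_path_H14_m1 H14 deg v by simp
  next
    case False
    show ?thesis
    proof (rule zdeg_path_H10[OF deg v])
      fix C assume "valid C" "eigs C \<noteq> {}" "eigs A = eigs C"
      then show "reaches A C" using H14 False v path_regular valid_H13_m1
        by (cases C) (auto simp: doubleton_eq_iff singleton_insert_inj_eq)
    qed (use H14 False v path_to_H10 in auto)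
  qed
next
  case H15
  show ?thesis
  proof (rule zdeg_path_H10[OF deg v])
    fix C assume "valid C" "eigs C \<noteq> {}" "eigs A = eigs C"
    then show "reaches A C" using H15 path_regular
      by (cases C) (auto simp: doubleton_eq_iff singleton_insert_inj_eq)
  qed (use H15 path_to_H10 in auto)
qed (use zdeg_path_low[OF deg _ v] zdeg_path_H04_H07[OF deg _ v(2)] zdeg_path_H12_H13[OF deg _ v] in auto)

theorem mainTheorem2:
  fixes A B :: alg
  assumes "valid A" and "valid B"
  shows "degenerates (alg_struct A) (alg_struct B) \<longleftrightarrow> gamma_edge\<^sup>*\<^sup>* A B"
  using assms zdeg_imp_path path_zdeg degenerates_iff_zdeg by blast

end
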